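(* Let $f=(f_1,\dots,f_s):\mathbb{R}^n\to\mathbb{R}^s$ be a locally Lipschitz mapping and let $K\subseteq\mathbb{R}^n$ be a nonempty closed set. The following assertions are equivalent: (i) The problem $\mathrm{VOP}(K,f)$ admits a weak Pareto efficient solution. (ii) There exist a nonempty index set $I\subseteq\{1,\dots,s\}$ and $x_0\in K$ such that $f$ is weakly section-bounded from below on $K$ with respect to $I$ and $x_0$, and the inclusion $\widetilde{K}^I_{\infty,\le f(x_0)}(f,K)\subseteq K^I_{0,\le f(x_0)}(f,K)$ holds. (iii) There exist a nonempty index set $I\subseteq\{1,\dots,s\}$ and $x_0\in K$ such that $f$ is weakly section-bounded from below on $K$ with respect to $I$ and $x_0$, and the inclusion $K^I_{\infty,\le f(x_0)}(f,K)\subseteq K^I_{0,\le f(x_0)}(f,K)$ holds. (iv) There exist a nonempty index set $I\subseteq\{1,\dots,s\}$ and $x_0\in K$ such that $f$ is weakly section-bounded from below on $K$ with respect to $I$ and $x_0$, and the inclusion $T^I_{\infty,\le f(x_0)}(f,K)\subseteq K^I_{0,\le f(x_0)}(f,K)$ holds.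
   Context: Inequalities between vectors are componentwise. $\mathrm{VOP}(K,f)$ is the problem of minimizing $f$ over $K$. A point $x^*\in K$ is a weak Pareto efficient solution if there is no $x\in K$ with $f_i(x)<f_i(x^* )$ for all $i=1,\dots,s$. For $I=\{s_1<\dots<s_q\}\subseteq\{1,\dots,s\}$ nonempty, $|I|=q$, put $f_I=(f_{s_1},\dots,f_{s_q})$. For $x_0\in K$ put $K_{x_0}=\{x\in K: f_i(x)\le f_i(x_0),\ i=1,\dots,s\}$. Weak section-boundedness: $f$ is weakly section-bounded from below on $K$ with respect to $I$ and $x_0$ if there is $\bar a\in\mathbb{R}^{|I|}$ with $\{f_I(x): x\in K_{x_0}\}\subseteq \bar a+\mathbb{R}^{|I|}_+$. Normal cones and subdifferentials: for $C\subseteq\mathbb{R}^m$ and $\bar x\in C$, the regular normal cone $\hat N(\bar x;C)$ is the set of $v$ with $\langle v,x-\bar x\rangle\le o(\|x-\bar x\|)$ for $x\in C$, $x\to\bar x$; the limiting normal cone $N(\bar x;C)$ is the set of all limits $v=\lim v_k$ with $v_k\in\hat N(x_k;C)$, $x_k\in C$, $x_k\to\bar x$. For $\varphi:\mathbb{R}^n\to\mathbb{R}$, the (limiting) subdifferential is $\partial\varphi(\bar x)=\{v: (v,-1)\in N((\bar x,\varphi(\bar x));\mathrm{epi}\,\varphi)\}$, where $\mathrm{epi}\,\varphi=\{(x,y):\varphi(x)\le y\}$. Extended Rabier function (for $x\in K$): $$\nu(x)=\inf\Big\{\Big\|\sum_{i=1}^s\alpha_iv_i+\omega\Big\| : v_i\in\partial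 f_i(x),\ \omega\in N(x;K),\ \alpha\in\mathbb{R}^s_+,\ \sum_{i=1}^s\alpha_i=1\Big\}.$$ Tangency variety: $\Gamma(f,K)$ is the set of $x\in K$ for which there exist $v_i\in\partial f_i(x)$ ($i=1,\dots,s$) and $(\alpha,\mu)\in\mathbb{R}^s_+\times\mathbb{R}$ with $\sum_{i=1}^s\alpha_i+|\mu|=1$ and $0\in\sum_{i=1}^s\alpha_iv_i+\mu x+N(x;K)$. For $y_0\in\mathbb{R}^s$: $\widetilde K^I_{\infty,\le y_0}(f,K)$ is the set of $y\in\mathbb{R}^{|I|}$ for which there is a sequence $\{x_k\}\subseteq K$ with $f(x_k)\le y_0$ for all $k$, $\|x_k\|\to+\infty$, $f_I(x_k)\to y$ and $\nu(x_k)\to0$. $K^I_{\infty,\le y_0}(f,K)$ is defined in the same way with $\nu(x_k)\to0$ replaced by $\|x_k\|\nu(x_k)\to0$. $T^I_{\infty,\le y_0}(f,K)$ is the set of $y\in\mathbb{R}^{|I|}$ for which there is a sequence $\{x_k\}\subseteq\Gamma(f,K)$ with $f(x_k)\le y_0$ for all $k$, $\|x_k\|\to+\infty$ and $f_I(x_k)\to y$. $K^I_{0,\le y_0}(f,K)=\{f_I(x): x\in K,\ f(x)\le y_0,\ \nu(x)=0\}$. *)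

theory Defs
  imports "HOL-Analysis.Analysis"
begin

text \<open>
  The decision space is \<^typ>\<open>real ^ 'n\<close>, the objective space is \<^typ>\<open>real ^ 's\<close>; the
  criteria are indexed by the elements of the finite type \<^typ>\<open>'s\<close>.  The order
  \<^term>\<open>(\<le>)\<close> on \<^typ>\<open>real ^ 's\<close> is the componentwise one, but \<^term>\<open>(<)\<close> is its strict part
  and therefore does not mean strict inequality in every component.
\<close>

definition locally_lipschitz :: "('a::metric_space \<Rightarrow> 'b::metric_space) \<Rightarrow> bool" where
  "locally_lipschitz f \<longleftrightarrow> (\<forall>x. \<exists>u>0. \<exists>L. L-lipschitz_on (cball x u) f)"


subsection \<open>Vector optimization\<close>

definition weak_pareto_efficient ::
    "(real ^ 'n) set \<Rightarrow> (real ^ 'n \<Rightarrow> real ^ 's) \<Rightarrow> real ^ 'n \<Rightarrow> bool" where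
  "weak_pareto_efficient K f xs \<longleftrightarrow> xs \<in> K \<and> \<not> (\<exists>x\<in>K. \<forall>i. f x $ i < f xs $ i)"

definition section_at ::
    "(real ^ 'n) set \<Rightarrow> (real ^ 'n \<Rightarrow> real ^ 's) \<Rightarrow> real ^ 'n \<Rightarrow> (real ^ 'n) set" where
  "section_at K f x0 = {x \<in> K. \<forall>i. f x $ i \<le> f x0 $ i}"

text \<open>
  For a set \<^term>\<open>I\<close> of criteria, the space of real vectors indexed by \<^term>\<open>I\<close> is the set of
  functions that are \<^term>\<open>undefined\<close> off \<^term>\<open>I\<close>.  Limits in it are taken in the
  product topology of \<^typ>\<open>'s \<Rightarrow> real\<close>, i.e. they are limits in each component \<^term>\<open>i \<in> I\<close>
  (off \<^term>\<open>I\<close>, everything is constant).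
\<close>

definition Rvec :: "'s set \<Rightarrow> ('s \<Rightarrow> real) set" where
  "Rvec I = (I \<rightarrow>\<^sub>E UNIV)"

definition subvec :: "(real ^ 'n \<Rightarrow> real ^ 's) \<Rightarrow> 's set \<Rightarrow> real ^ 'n \<Rightarrow> 's \<Rightarrow> real" where
  "subvec f I x = (\<lambda>i\<in>I. f x $ i)"

definition weakly_section_bounded_below ::
    "(real ^ 'n) set \<Rightarrow> (real ^ 'n \<Rightarrow> real ^ 's) \<Rightarrow> 's set \<Rightarrow> real ^ 'n \<Rightarrow> bool" where
  "weakly_section_bounded_below K f I x0 \<longleftrightarrow>
     (\<exists>a \<in> Rvec I. subvec f I ` section_at K f x0 \<subseteq> {y \<in> Rvec I. \<forall>i\<in>I. a i \<le> y i})"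


subsection \<open>Normal cones and subdifferentials\<close>

text \<open>
  Both cones are empty when the base point is not in \<^term>\<open>C\<close>.  The condition
  \<open>\<langle>v, x - xb\<rangle> \<le> o(\<parallel>x - xb\<parallel>)\<close> is one-sided and is written out.
\<close>

definition regular_normal_cone :: "'a::euclidean_space \<Rightarrow> 'a set \<Rightarrow> 'a set" where
  "regular_normal_cone xb C =
     {v. xb \<in> C \<and>
         (\<forall>\<epsilon>>0. \<forall>\<^sub>F x in at xb within C. inner v (x - xb) \<le> \<epsilon> * norm (x - xb))}"

definition limiting_normal_cone :: "'a::euclidean_space \<Rightarrow> 'a set \<Rightarrow> 'a set" where
  "limiting_normal_cone xb C =
     {v. xb \<in> C \<and>
         (\<exists>(x :: nat \<Rightarrow> 'a) w. (\<forall>k. x k \<in> C \<and> w k \<in> regular_normal_cone (x k) C) \<and>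
            x \<longlonglongrightarrow> xb \<and> w \<longlonglongrightarrow> v)}"

definition limiting_subdiff :: "('a::euclidean_space \<Rightarrow> real) \<Rightarrow> 'a \<Rightarrow> 'a set" where
  "limiting_subdiff \<phi> xb = {v. (v, -1) \<in> limiting_normal_cone (xb, \<phi> xb) (epigraph UNIV \<phi>)}"


subsection \<open>Extended Rabier function and tangency variety\<close>

text \<open>The infimum is taken in \<^typ>\<open>ereal\<close>, so that the infimum of the empty set is \<^term>\<open>\<infinity> :: ereal\<close>.\<close>

definition rabier ::
    "(real ^ 'n \<Rightarrow> real ^ 's) \<Rightarrow> (real ^ 'n) set \<Rightarrow> real ^ 'n \<Rightarrow> ereal" where
  "rabier f K x =
     Inf {ereal (norm ((\<Sum>i\<in>UNIV. \<alpha> $ i *\<^sub>R v i) + \<omega>)) | (v :: 's \<Rightarrow> real ^ 'n) \<omega> (\<alpha> :: real ^ 's).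
            (\<forall>i. v i \<in> limiting_subdiff (\<lambda>z. f z $ i) x) \<and>
            \<omega> \<in> limiting_normal_cone x K \<and>
            (\<forall>i. 0 \<le> \<alpha> $ i) \<and> (\<Sum>i\<in>UNIV. \<alpha> $ i) = 1}"

definition tangency_variety ::
    "(real ^ 'n \<Rightarrow> real ^ 's) \<Rightarrow> (real ^ 'n) set \<Rightarrow> (real ^ 'n) set" where
  "tangency_variety f K =
     {x \<in> K. \<exists>(v :: 's \<Rightarrow> real ^ 'n) (\<alpha> :: real ^ 's) (\<mu> :: real).
        (\<forall>i. v i \<in> limiting_subdiff (\<lambda>z. f z $ i) x) \<and>
        (\<forall>i. 0 \<le> \<alpha> $ i) \<and> (\<Sum>i\<in>UNIV. \<alpha> $ i) + \<bar>\<mu>\<bar> = 1 \<and>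
        (\<exists>\<omega> \<in> limiting_normal_cone x K. 0 = (\<Sum>i\<in>UNIV. \<alpha> $ i *\<^sub>R v i) + \<mu> *\<^sub>R x + \<omega>)}"


subsection \<open>Asymptotic and critical values below \<open>y0\<close>\<close>

definition Ktilde_inf ::
    "(real ^ 'n \<Rightarrow> real ^ 's) \<Rightarrow> (real ^ 'n) set \<Rightarrow> 's set \<Rightarrow> real ^ 's \<Rightarrow> ('s \<Rightarrow> real) set" where
  "Ktilde_inf f K I y0 =
     {y \<in> Rvec I. \<exists>x :: nat \<Rightarrow> real ^ 'n.
        (\<forall>k. x k \<in> K \<and> f (x k) \<le> y0) \<and>
        filterlim (\<lambda>k. norm (x k)) at_top sequentially \<and>
        (\<lambda>k. subvec f I (x k)) \<longlonglongrightarrow> y \<and>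
        (\<lambda>k. rabier f K (x k)) \<longlonglongrightarrow> 0}"

definition K_inf ::
    "(real ^ 'n \<Rightarrow> real ^ 's) \<Rightarrow> (real ^ 'n) set \<Rightarrow> 's set \<Rightarrow> real ^ 's \<Rightarrow> ('s \<Rightarrow> real) set" where
  "K_inf f K I y0 =
     {y \<in> Rvec I. \<exists>x :: nat \<Rightarrow> real ^ 'n.
        (\<forall>k. x k \<in> K \<and> f (x k) \<le> y0) \<and>
        filterlim (\<lambda>k. norm (x k)) at_top sequentially \<and>
        (\<lambda>k. subvec f I (x k)) \<longlonglongrightarrow> y \<and>
        (\<lambda>k. ereal (norm (x k)) * rabier f K (x k)) \<longlonglongrightarrow> 0}"

definition T_inf ::
    "(real ^ 'n \<Rightarrow> real ^ 's) \<Rightarrow> (real ^ 'n) set \<Rightarrow> 's set \<Rightarrow> real ^ 's \<Rightarrow> ('s \<Rightarrow> real) set" where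
  "T_inf f K I y0 =
     {y \<in> Rvec I. \<exists>x :: nat \<Rightarrow> real ^ 'n.
        (\<forall>k. x k \<in> tangency_variety f K \<and> f (x k) \<le> y0) \<and>
        filterlim (\<lambda>k. norm (x k)) at_top sequentially \<and>
        (\<lambda>k. subvec f I (x k)) \<longlonglongrightarrow> y}"

definition K_zero ::
    "(real ^ 'n \<Rightarrow> real ^ 's) \<Rightarrow> (real ^ 'n) set \<Rightarrow> 's set \<Rightarrow> real ^ 's \<Rightarrow> ('s \<Rightarrow> real) set" where
  "K_zero f K I y0 = {subvec f I x | x. x \<in> K \<and> f x \<le> y0 \<and> rabier f K x = 0}"

end

theory Submission
  imports Defs
begin

text \<open>
  \<^emph>\<open>Existence from asymptotic conditions.\<close>  Fix \<^term>\<open>j \<in> I\<close> and let \<open>S\<close> be the points of \<open>K\<close> with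
  \<open>f i x \<le> f i x0\<close> for all \<open>i \<noteq> j\<close>.  A minimiser of \<open>f j\<close> over \<open>S\<close> is weakly efficient.  If there is
  none, minimisers \<open>x n\<close> of \<open>f j + d n * ln (1 + \<parallel>x\<parallel>\<^sup>2)\<close> over \<open>S\<close> with \<open>d n \<rightarrow> 0\<close> still exist, escape to
  infinity and make \<open>f j\<close> converge to its infimum.  The penalty has a radial gradient of norm
  at most \<open>2 * d n / \<parallel>x\<parallel>\<close>, so the multiplier rule places \<open>x n\<close> in the tangency variety and gives
  \<open>\<parallel>x n\<parallel> * \<nu> (x n) \<rightarrow> 0\<close> at the same time.  A limit of \<open>f_I (x n)\<close> is therefore in all three asymptotic
  sets, but it is not a value of \<open>f_I\<close> on the section since the infimum of \<open>f j\<close> is not attained.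

  \<^emph>\<open>Converse.\<close>  Every point of the section at a weakly efficient \<open>x*\<close> is weakly efficient and shares
  at least one objective value with \<open>x*\<close>.  If \<open>x0\<close> shares as few as possible, indexed by \<open>I\<close>, then
  \<open>f_I\<close> is constant on the section at \<open>x0\<close>, and \<open>\<nu> x0 = 0\<close> by the multiplier rule.

  \<^emph>\<open>Multiplier rule.\<close>  Each objective gets its own copy \<open>Z i\<close> of the variable, tied to \<open>z \<in> K\<close> by the
  penalty \<open>k * \<parallel>z - Z i\<parallel>\<^sup>2\<close>, and the maximum of the objectives is replaced by log-sum-exp.  The
  stationarity conditions in \<open>z\<close> and in each \<open>Z i\<close> then separate, and the gradient of log-sum-exp is a
  positive probability vector, so that every objective (also one with vanishing multiplier in
  the limit) contributes a regular subgradient.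
\<close>

subsection \<open>Regular and limiting normals\<close>

lemma regular_normal_cone_scaleR:
  assumes "v \<in> regular_normal_cone x C" "0 \<le> t"
  shows "t *\<^sub>R v \<in> regular_normal_cone x C"
proof (cases "t = 0")
  case True
  then show ?thesis using assms(1) by (simp add: regular_normal_cone_def)
next
  case False
  then have t: "0 < t" using assms by simp
  have "\<forall>\<^sub>F y in at x within C. inner (t *\<^sub>R v) (y - x) \<le> e * norm (y - x)" if "0 < e" for e
  proof -
    have "0 < e / t" using t that by simp
    then have "\<forall>\<^sub>F y in at x within C. inner v (y - x) \<le> (e / t) * norm (y - x)"
      using assms(1) unfolding regular_normal_cone_def by blast
    then show ?thesis
      by eventually_elim (use t in \<open>simp add: field_simps\<close>)
  qed
  then show ?thesis using assms(1) by (simp add: regular_normal_cone_def)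
qed

lemma limiting_normal_cone_scaleR:
  assumes "v \<in> limiting_normal_cone x C" "0 \<le> t"
  shows "t *\<^sub>R v \<in> limiting_normal_cone x C"
proof -
  obtain y w where "\<And>k. y k \<in> C \<and> w k \<in> regular_normal_cone (y k) C" "y \<longlonglongrightarrow> x" "w \<longlonglongrightarrow> v"
    using assms(1) by (auto simp: limiting_normal_cone_def)
  then have "(\<forall>k. y k \<in> C \<and> t *\<^sub>R w k \<in> regular_normal_cone (y k) C) \<and> y \<longlonglongrightarrow> x \<and>
      (\<lambda>k. t *\<^sub>R w k) \<longlonglongrightarrow> t *\<^sub>R v"
    using assms(2) by (auto intro!: regular_normal_cone_scaleR tendsto_intros)
  then show ?thesis
    using assms(1) unfolding limiting_normal_cone_def mem_Collect_eq
    by (intro conjI exI[of _ y] exI[of _ "\<lambda>k. t *\<^sub>R w k"]) auto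
qed

lemma limiting_normal_coneI:
  assumes "xb \<in> C" "\<And>k. w k \<in> regular_normal_cone (x k) C" "x \<longlonglongrightarrow> xb" "w \<longlonglongrightarrow> v"
  shows "v \<in> limiting_normal_cone xb C"
proof -
  have "x k \<in> C" for k
    using assms(2)[of k] by (simp add: regular_normal_cone_def)
  then show ?thesis
    using assms by (auto simp: limiting_normal_cone_def)
qed

text \<open>Fermat rule on \<open>C\<close>: since \<open>\<psi>\<close> does not decrease from
  \<open>xb\<close>, its first-order expansion bounds the inner product with \<open>- g\<close> by
  the error term alone.\<close>

lemma neg_gradient_regular_normal:
  assumes "xb \<in> C" and der: "(\<psi> has_derivative (\<lambda>h. inner g h)) (at xb)"
    and min: "\<forall>\<^sub>F x in at xb within C. \<psi> xb \<le> \<psi> x"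
  shows "- g \<in> regular_normal_cone xb C"
proof -
  have "\<forall>\<^sub>F x in at xb within C. inner (- g) (x - xb) \<le> e * norm (x - xb)" if "0 < e" for e
  proof -
    have "\<forall>\<^sub>F x in at xb within C. norm (\<psi> x - \<psi> xb - inner g (x - xb)) \<le> e * norm (x - xb)"
      using has_derivative_at_withinI[OF der, of C] that
      by (auto simp: has_derivative_within_alt2)
    with min show ?thesis
      by eventually_elim (auto simp: abs_le_iff)
  qed
  then show ?thesis using assms(1) by (simp add: regular_normal_cone_def)
qed

text \<open>By the Lipschitz bound, small steps along \<open>(v, L * norm v)\<close> stay in the
  epigraph. A regular normal has no positive pairing with such a direction, and for
  \<open>(v, -1)\<close> the pairing is \<open>norm v * (norm v - L)\<close>.\<close>

lemma norm_regular_subgradient_le: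
  fixes \<phi> :: "'a::euclidean_space \<Rightarrow> real"
  assumes v: "(v, -1) \<in> regular_normal_cone (x, \<phi> x) (epigraph UNIV \<phi>)"
    and lip: "L-lipschitz_on (cball x d) \<phi>" and "0 < d"
  shows "norm v \<le> L"
proof (rule ccontr)
  assume "\<not> norm v \<le> L"
  then have L: "L < norm v" by simp
  have L0: "0 \<le> L" using lip by (rule lipschitz_on_nonneg)
  then have v0: "0 < norm v" using L by linarith
  define u where "u = (v, L * norm v)"
  have u0: "u \<noteq> 0" using v0 by (auto simp: u_def zero_prod_def)
  \<comment> \<open>Makes \<open>e * norm u\<close> half of the pairing of \<open>(v, -1)\<close>
    with \<open>u\<close>, which is positive under the contrary assumption.\<close>
  define e where "e = norm v * (norm v - L) / (2 * norm u)"
  have e0: "0 < e" using v0 L u0 by (simp add: e_def)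
  have "\<forall>\<^sub>F y in at (x, \<phi> x) within epigraph UNIV \<phi>.
      inner (v, -1) (y - (x, \<phi> x)) \<le> e * norm (y - (x, \<phi> x))"
    using v e0 unfolding regular_normal_cone_def by blast
  then obtain \<rho> where \<rho>: "0 < \<rho>"
    and ineq: "\<And>y. y \<in> epigraph UNIV \<phi> \<Longrightarrow> y \<noteq> (x, \<phi> x) \<Longrightarrow> dist y (x, \<phi> x) < \<rho> \<Longrightarrow>
      inner (v, -1) (y - (x, \<phi> x)) \<le> e * norm (y - (x, \<phi> x))"
    unfolding eventually_at by auto
  \<comment> \<open>The first bound keeps the test point within distance \<open>\<rho>\<close>, the
    second keeps \<open>x + t *\<^sub>R v\<close> in the ball where \<open>\<phi>\<close> is
    Lipschitz.\<close>
  define t where "t = min (\<rho> / (2 * norm u)) (d / norm v)"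
  have t: "0 < t" "t * norm v \<le> d" "t * norm u < \<rho>"
  proof -
    show "0 < t" using \<rho> u0 v0 assms(3) by (simp add: t_def)
    have "t \<le> d / norm v" by (simp add: t_def)
    then show "t * norm v \<le> d" using v0 by (simp add: field_simps)
    have "t \<le> \<rho> / (2 * norm u)" by (simp add: t_def)
    then have "t * norm u \<le> \<rho> / 2" using u0 by (simp add: field_simps)
    then show "t * norm u < \<rho>" using \<rho> by linarith
  qed
  define y where "y = (x, \<phi> x) + t *\<^sub>R u"
  have "dist (\<phi> (x + t *\<^sub>R v)) (\<phi> x) \<le> L * dist (x + t *\<^sub>R v) x"
    using t assms(3) by (intro lipschitz_onD[OF lip]) (auto simp: dist_norm)
  then have "\<phi> (x + t *\<^sub>R v) \<le> \<phi> x + t * (L * norm v)"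
    using t by (auto simp: dist_norm abs_le_iff algebra_simps)
  then have "y \<in> epigraph UNIV \<phi>"
    by (simp add: y_def u_def mem_epigraph)
  moreover have "y \<noteq> (x, \<phi> x)" "dist y (x, \<phi> x) < \<rho>"
    using t u0 by (auto simp: y_def dist_norm)
  ultimately have "inner (v, -1) (t *\<^sub>R u) \<le> e * norm (t *\<^sub>R u)"
    using ineq[of y] by (simp add: y_def)
  moreover have "inner (v, -1) (t *\<^sub>R u) = t * (norm v * norm v - L * norm v)"
    by (simp add: u_def algebra_simps dot_square_norm power2_eq_square)
  moreover have "e * norm (t *\<^sub>R u) = t * (e * norm u)"
    using t by simp
  ultimately have "t * (norm v * norm v - L * norm v) \<le> t * (e * norm u)"
    by linarith
  then have "norm v * norm v - L * norm v \<le> e * norm u"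
    using t by simp
  then have "norm v * (norm v - L) \<le> e * norm u"
    by (simp add: algebra_simps)
  also have "\<dots> = norm v * (norm v - L) / 2"
    using u0 by (simp add: e_def)
  finally show False
    using mult_pos_pos[of "norm v" "norm v - L"] v0 L by linarith
qed


subsection \<open>Log-sum-exp\<close>

text \<open>A smooth surrogate for the maximum: for \<open>k > 0\<close> it lies between the maximum
  and the maximum plus \<open>ln CARD('s) / k\<close>.\<close>

definition lse :: "real \<Rightarrow> ('s::finite \<Rightarrow> real) \<Rightarrow> real" where
  "lse k u = ln (\<Sum>i\<in>UNIV. exp (k * u i)) / k"

definition softmax :: "real \<Rightarrow> ('s::finite \<Rightarrow> real) \<Rightarrow> 's \<Rightarrow> real" where
  "softmax k u i = exp (k * u i) / (\<Sum>j\<in>UNIV. exp (k * u j))"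

lemma sum_exp_pos: "0 < (\<Sum>i\<in>(UNIV :: 's::finite set). exp (g i :: real))"
  by (intro sum_pos) auto

lemma softmax_pos: "0 < softmax k u i"
  by (simp add: softmax_def sum_exp_pos)

lemma sum_softmax: "(\<Sum>i\<in>UNIV. softmax k u i) = 1"
  using sum_exp_pos[of "\<lambda>i. k * u i"] by (simp add: softmax_def flip: sum_divide_distrib)

lemma lse_mono:
  assumes "0 < k" "\<And>i. u i \<le> w i"
  shows "lse k u \<le> lse k w"
  using assms by (auto simp: lse_def sum_exp_pos intro!: divide_right_mono sum_mono)

lemma le_lse:
  assumes "0 < k"
  shows "u i \<le> lse k u"
proof -
  have "exp (k * u i) \<le> (\<Sum>i\<in>UNIV. exp (k * u i))"
    by (rule member_le_sum) auto
  then have "k * u i \<le> ln (\<Sum>i\<in>UNIV. exp (k * u i))"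
    by (simp add: ln_ge_iff sum_exp_pos)
  then show ?thesis using assms by (simp add: lse_def field_simps)
qed

lemma lse_const: "lse k (\<lambda>i::'s::finite. 0) = ln (real CARD('s)) / k"
  by (simp add: lse_def)

lemma has_derivative_lse:
  fixes u :: "'a::real_normed_vector \<Rightarrow> 's::finite \<Rightarrow> real"
  assumes "\<And>i. ((\<lambda>x. u x i) has_derivative u' i) (at x)" "k \<noteq> 0"
  shows "((\<lambda>x. lse k (u x)) has_derivative (\<lambda>h. \<Sum>i\<in>UNIV. softmax k (u x) i * u' i h)) (at x)"
proof -
  let ?S = "\<Sum>i\<in>UNIV. exp (k * u x i)"
  have "((\<lambda>x. \<Sum>i\<in>UNIV. exp (k * u x i)) has_derivative
      (\<lambda>h. \<Sum>i\<in>UNIV. (k * u' i h) * exp (k * u x i))) (at x)"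
    by (intro has_derivative_sum has_derivative_exp has_derivative_mult_right assms)
  then have "((\<lambda>x. ln (\<Sum>i\<in>UNIV. exp (k * u x i))) has_derivative
      (\<lambda>h. (\<Sum>i\<in>UNIV. (k * u' i h) * exp (k * u x i)) * inverse ?S)) (at x)"
    by (intro has_derivative_ln sum_exp_pos)
  then have "((\<lambda>x. lse k (u x)) has_derivative
      (\<lambda>h. (\<Sum>i\<in>UNIV. (k * u' i h) * exp (k * u x i)) * inverse ?S / k)) (at x)"
    unfolding lse_def divide_inverse by (rule has_derivative_mult_left)
  moreover have "(\<Sum>i\<in>UNIV. (k * u' i h) * exp (k * u x i)) * inverse ?S / k =
      (\<Sum>i\<in>UNIV. softmax k (u x) i * u' i h)" for h
    unfolding softmax_def sum_distrib_right sum_divide_distrib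
    by (rule sum.cong) (use assms(2) in \<open>auto simp: divide_inverse\<close>)
  ultimately show ?thesis by simp
qed

lemma continuous_on_lse:
  assumes "\<And>i. continuous_on S (\<lambda>x. u x i)" "k \<noteq> 0"
  shows "continuous_on S (\<lambda>x. lse k (u x))"
  unfolding lse_def
  by (intro continuous_intros assms) (use assms(2) in \<open>auto simp: sum_exp_pos[THEN less_imp_neq, symmetric]\<close>)

subsection \<open>Decoupling by penalisation\<close>

text \<open>The nonsmooth parts \<open>\<phi> i\<close> act on the copies \<open>Z i\<close>, the
  smooth parts \<open>p i\<close> stay at \<open>z\<close>, and \<open>c i\<close> is a target
  level. The last square draws minimisers towards \<open>xb\<close>; a single \<open>k\<close>
  drives both the smoothing and the coupling.\<close>

definition penalty ::
    "('s::finite \<Rightarrow> 'a::euclidean_space \<Rightarrow> real) \<Rightarrow> ('s \<Rightarrow> 'a \<Rightarrow> real) \<Rightarrow> ('s \<Rightarrow> real) \<Rightarrow> 'a \<Rightarrow> real \<Rightarrow>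
      'a \<Rightarrow> ('s \<Rightarrow> 'a) \<Rightarrow> real" where
  "penalty \<phi> p c xb k z Z =
     lse k (\<lambda>i. \<phi> i (Z i) + p i z - c i) + k * (\<Sum>i\<in>UNIV. (norm (z - Z i))\<^sup>2) + (norm (z - xb))\<^sup>2"

lemma penalty_minimizer_exists:
  fixes \<phi> p :: "'s::finite \<Rightarrow> 'a::euclidean_space \<Rightarrow> real"
  assumes "closed K" "xb \<in> K" "0 \<le> r"
    and \<phi>: "\<And>i. continuous_on (cball xb r) (\<phi> i)" and p: "\<And>i. continuous_on UNIV (p i)" and "k \<noteq> 0"
  obtains z Z where "z \<in> K \<inter> cball xb r" "\<And>i. Z i \<in> cball xb r"
    "\<And>z' Z'. z' \<in> K \<inter> cball xb r \<Longrightarrow> (\<And>i. Z' i \<in> cball xb r) \<Longrightarrow>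
      penalty \<phi> p c xb k z Z \<le> penalty \<phi> p c xb k z' Z'"
proof -
  let ?B = "cball xb r"
  \<comment> \<open>Packing the copies into one vector turns the problem into minimisation over a
    compact set.\<close>
  define D where "D = (K \<inter> ?B) \<times> {W :: 'a ^ 's. \<forall>i. W $ i \<in> ?B}"
  have "bounded {W :: 'a ^ 's. \<forall>i. W $ i \<in> ?B}"
  proof (rule boundedI)
    fix W :: "'a ^ 's" assume W: "W \<in> {W. \<forall>i. W $ i \<in> ?B}"
    have "norm (W $ i) \<le> norm xb + r" for i
    proof -
      have "norm (W $ i) \<le> norm xb + norm (W $ i - xb)" by (rule norm_triangle_sub)
      also have "norm (W $ i - xb) \<le> r" using W by (simp add: dist_norm norm_minus_commute)
      finally show ?thesis by simp
    qed
    then show "norm W \<le> norm ((\<chi> i. norm xb + r) :: real ^ 's)"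
      using assms(3) by (intro norm_le_componentwise_cart) auto
  qed
  moreover have "closed {W :: 'a ^ 's. \<forall>i. W $ i \<in> ?B}"
    by (rule closed_vector_box) auto
  ultimately have "compact D"
    unfolding D_def using assms(1)
    by (intro compact_Times closed_Int_compact compact_cball) (auto simp: compact_eq_bounded_closed)
  moreover have "D \<noteq> {}"
    using assms(2,3) by (auto simp: D_def intro!: exI[of _ xb] exI[of _ "\<chi> i. xb"])
  moreover have "continuous_on D (\<lambda>w. penalty \<phi> p c xb k (fst w) (\<lambda>i. snd w $ i))"
  proof -
    have "continuous_on D (\<lambda>w. \<phi> i (snd w $ i))" for i
      by (rule continuous_on_compose2[OF \<phi>[of i]]) (auto simp: D_def intro!: continuous_intros)
    moreover have "continuous_on D (\<lambda>w. p i (fst w))" for i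
      by (rule continuous_on_compose2[OF p[of i]]) (auto intro!: continuous_intros)
    ultimately show ?thesis
      unfolding penalty_def using assms(6)
      by (intro continuous_intros continuous_on_lse) auto
  qed
  ultimately obtain w where w: "w \<in> D"
    and min: "\<And>w'. w' \<in> D \<Longrightarrow>
      penalty \<phi> p c xb k (fst w) (\<lambda>i. snd w $ i) \<le> penalty \<phi> p c xb k (fst w') (\<lambda>i. snd w' $ i)"
    using continuous_attains_inf[of D "\<lambda>w. penalty \<phi> p c xb k (fst w) (\<lambda>i. snd w $ i)"] by blast
  show thesis
  proof (rule that[of "fst w" "\<lambda>i. snd w $ i"])
    fix z' and Z' :: "'s \<Rightarrow> 'a" assume "z' \<in> K \<inter> ?B" "\<And>i. Z' i \<in> ?B"
    then show "penalty \<phi> p c xb k (fst w) (\<lambda>i. snd w $ i) \<le> penalty \<phi> p c xb k z' Z'"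
      using min[of "(z', \<chi> i. Z' i)"] by (simp add: D_def)
  qed (use w in \<open>auto simp: D_def\<close>)
qed

text \<open>With \<open>z\<close> and all copies at \<open>xb\<close> the penalty is at most
  \<open>ln CARD('s) / k\<close>. From below, the index given by \<open>lower\<close> keeps
  log-sum-exp above \<open>- L * norm (z - Z i)\<close>, and half of the coupling absorbs this term.
  What remains makes both squared distances of order \<open>1 / k\<close>.\<close>

lemma penalty_sublevel_le:
  fixes \<phi> p :: "'s::finite \<Rightarrow> 'a::euclidean_space \<Rightarrow> real"
  assumes lip: "\<And>i. L-lipschitz_on (cball xb r) (\<phi> i)"
    and upper: "\<And>i. \<phi> i xb + p i xb \<le> c i"
    and lower: "\<exists>i. c i \<le> \<phi> i z + p i z"
    and B: "z \<in> cball xb r" "\<And>i. Z i \<in> cball xb r"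
    and le: "penalty \<phi> p c xb k z Z \<le> penalty \<phi> p c xb k xb (\<lambda>_. xb)" and k: "2 \<le> k"
  shows "(norm (z - xb))\<^sup>2 \<le> (ln CARD('s) + L\<^sup>2 / 2) / k"
    and "(norm (z - Z m))\<^sup>2 \<le> (ln CARD('s) + L\<^sup>2 / 2) / k"
proof -
  let ?u = "\<lambda>i. \<phi> i (Z i) + p i z - c i" and ?S = "\<Sum>i\<in>UNIV. (norm (z - Z i))\<^sup>2"
  define C where "C = ln (real CARD('s)) + L\<^sup>2 / 2"
  obtain i where i: "c i \<le> \<phi> i z + p i z" using lower by blast
  define t where "t = norm (z - Z i)"
  have "dist (\<phi> i z) (\<phi> i (Z i)) \<le> L * dist z (Z i)"
    using B by (intro lipschitz_onD[OF lip])
  then have "- (L * t) \<le> ?u i" using i by (auto simp: dist_norm t_def abs_le_iff)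
  also have "?u i \<le> lse k ?u" using k by (intro le_lse[where u = ?u]) auto
  finally have lse_ge: "- (L * t) \<le> lse k ?u" .
  have "penalty \<phi> p c xb k xb (\<lambda>_. xb) = lse k (\<lambda>i. \<phi> i xb + p i xb - c i)"
    by (simp add: penalty_def)
  also have "\<dots> \<le> lse k (\<lambda>i::'s. 0)" using k upper by (intro lse_mono) auto
  finally have pen: "lse k ?u + k * ?S + (norm (z - xb))\<^sup>2 \<le> ln (real CARD('s)) / k"
    using le by (simp add: penalty_def lse_const)
  have S: "(norm (z - Z m))\<^sup>2 \<le> ?S" for m by (rule member_le_sum) auto
  \<comment> \<open>Young's inequality, by expanding the square of \<open>k * t - L\<close>.\<close>
  have "2 * k * (L * t) \<le> k\<^sup>2 * t\<^sup>2 + L\<^sup>2"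
    using zero_le_power2[of "k * t - L"] by (simp add: power2_eq_square algebra_simps)
  then have "L * t \<le> (k\<^sup>2 * t\<^sup>2 + L\<^sup>2) / (2 * k)"
    using k by (simp add: pos_le_divide_eq mult_ac)
  also have "\<dots> = k / 2 * t\<^sup>2 + L\<^sup>2 / (2 * k)"
    using k by (simp add: add_divide_distrib power2_eq_square)
  also have "\<dots> \<le> k / 2 * ?S + L\<^sup>2 / (2 * k)"
    using S[of i] k by (simp add: t_def)
  finally have main: "k / 2 * ?S + (norm (z - xb))\<^sup>2 \<le> C / k"
    using pen lse_ge k by (simp add: C_def add_divide_distrib)
  moreover have S0: "0 \<le> ?S" by (intro sum_nonneg) auto
  ultimately show "(norm (z - xb))\<^sup>2 \<le> (ln CARD('s) + L\<^sup>2 / 2) / k"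
    using k mult_nonneg_nonneg[of "k / 2" ?S] unfolding C_def by linarith
  \<comment> \<open>Since \<open>k / 2\<close> is at least 1, the half of the coupling that is left
    still dominates the plain sum of squares.\<close>
  have "?S \<le> k / 2 * ?S" using k S0 mult_right_mono[of 1 "k / 2" ?S] by simp
  then show "(norm (z - Z m))\<^sup>2 \<le> (ln CARD('s) + L\<^sup>2 / 2) / k"
    using main S[of m] zero_le_power2[of "norm (z - xb)"] unfolding C_def by linarith
qed

text \<open>Freeze everything except \<open>Z i\<close> and let its function value vary freely above
  \<open>\<phi> i\<close>. As log-sum-exp is monotone, \<open>(Z i, \<phi> i (Z i))\<close> still
  locally minimises a smooth function on the epigraph, so the negative gradient is a regular
  normal.\<close>

lemma penalty_min_subgradient:
  fixes \<phi> p :: "'s::finite \<Rightarrow> 'a::euclidean_space \<Rightarrow> real"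
  assumes k: "0 < k" and Zi: "Z i \<in> ball xb r"
    and min: "\<And>x. x \<in> cball xb r \<Longrightarrow> penalty \<phi> p c xb k z Z \<le> penalty \<phi> p c xb k z (Z(i := x))"
  shows "((2 * k / softmax k (\<lambda>i. \<phi> i (Z i) + p i z - c i) i) *\<^sub>R (z - Z i), -1)
    \<in> regular_normal_cone (Z i, \<phi> i (Z i)) (epigraph UNIV (\<phi> i))"
proof -
  let ?u = "\<lambda>w m. (if m = i then snd w else \<phi> m (Z m)) + p m z - c m"
  let ?q = "\<lambda>w m. (norm (z - (if m = i then fst w else Z m)))\<^sup>2"
  define \<psi> where "\<psi> = (\<lambda>w :: 'a \<times> real. lse k (?u w) + k * (\<Sum>m\<in>UNIV. ?q w m) + (norm (z - xb))\<^sup>2)"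
  define a where "a = softmax k (\<lambda>i. \<phi> i (Z i) + p i z - c i) i"
  let ?w = "(Z i, \<phi> i (Z i))"
  have a: "0 < a" by (simp add: a_def softmax_pos)
  have u: "?u ?w = (\<lambda>i. \<phi> i (Z i) + p i z - c i)" by (auto simp: fun_eq_iff)
  have "((\<lambda>w. ?u w m) has_derivative (\<lambda>h. if m = i then snd h else 0)) (at ?w)" for m
    by (cases "m = i") (auto intro!: derivative_eq_intros)
  then have "((\<lambda>w. lse k (?u w)) has_derivative
      (\<lambda>h. \<Sum>m\<in>UNIV. softmax k (?u ?w) m * (if m = i then snd h else 0))) (at ?w)"
    using k by (intro has_derivative_lse) auto
  then have d1: "((\<lambda>w. lse k (?u w)) has_derivative (\<lambda>h. a * snd h)) (at ?w)"
    unfolding u a_def by (simp add: if_distrib cong: if_cong)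
  have "((\<lambda>w. ?q w m) has_derivative (\<lambda>h. if m = i then 2 * inner (Z i - z) (fst h) else 0)) (at ?w)" for m
    unfolding power2_norm_eq_inner
    by (cases "m = i") (auto intro!: derivative_eq_intros simp: fun_eq_iff inner_commute algebra_simps)
  then have "((\<lambda>w. \<Sum>m\<in>UNIV. ?q w m) has_derivative
      (\<lambda>h. \<Sum>m\<in>UNIV. if m = i then 2 * inner (Z i - z) (fst h) else 0)) (at ?w)"
    by (rule has_derivative_sum)
  then have d2: "((\<lambda>w. \<Sum>m\<in>UNIV. ?q w m) has_derivative (\<lambda>h. 2 * inner (Z i - z) (fst h))) (at ?w)"
    by simp
  have "(\<psi> has_derivative (\<lambda>h. a * snd h + k * (2 * inner (Z i - z) (fst h)) + 0)) (at ?w)"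
    unfolding \<psi>_def by (intro has_derivative_add has_derivative_mult_right d1 d2 has_derivative_const)
  then have der: "(\<psi> has_derivative (\<lambda>h. inner ((2 * k) *\<^sub>R (Z i - z), a) h)) (at ?w)"
    by (simp add: inner_prod_def algebra_simps)
  have "\<forall>\<^sub>F w in at ?w within epigraph UNIV (\<phi> i). fst w \<in> ball xb r"
    by (rule topological_tendstoD[OF tendsto_fst[OF tendsto_ident_at]]) (use Zi in auto)
  moreover have "\<forall>\<^sub>F w in at ?w within epigraph UNIV (\<phi> i). w \<in> epigraph UNIV (\<phi> i)"
    by (simp add: eventually_at_filter)
  ultimately have "\<forall>\<^sub>F w in at ?w within epigraph UNIV (\<phi> i). \<psi> ?w \<le> \<psi> w"
  proof eventually_elim
    fix w assume w: "fst w \<in> ball xb r" "w \<in> epigraph UNIV (\<phi> i)"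
    let ?Z = "Z(i := fst w)"
    have "\<psi> ?w = penalty \<phi> p c xb k z Z"
    proof -
      have "?q ?w = (\<lambda>m. (norm (z - Z m))\<^sup>2)" by (auto simp: fun_eq_iff)
      then show ?thesis unfolding \<psi>_def penalty_def u by (simp only:)
    qed
    also have "\<dots> \<le> penalty \<phi> p c xb k z ?Z"
      using w by (intro min) auto
    also have "\<dots> \<le> \<psi> w"
    proof -
      have "lse k (\<lambda>m. \<phi> m (?Z m) + p m z - c m) \<le> lse k (?u w)"
        using w k by (intro lse_mono) (auto simp: epigraph_def)
      then show ?thesis by (simp add: \<psi>_def penalty_def fun_upd_def)
    qed
    finally show "\<psi> ?w \<le> \<psi> w" .
  qed
  then have "- ((2 * k) *\<^sub>R (Z i - z), a) \<in> regular_normal_cone ?w (epigraph UNIV (\<phi> i))"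
    by (intro neg_gradient_regular_normal[OF _ der]) (auto simp: mem_epigraph)
  \<comment> \<open>Dividing by the softmax weight normalises the last coordinate to -1; this is
    possible because the weight is strictly positive.\<close>
  then have "(1 / a) *\<^sub>R (- ((2 * k) *\<^sub>R (Z i - z), a)) \<in> regular_normal_cone ?w (epigraph UNIV (\<phi> i))"
    using a by (intro regular_normal_cone_scaleR) auto
  moreover have "(1 / a) *\<^sub>R (- ((2 * k) *\<^sub>R (Z i - z), a)) = ((2 * k / a) *\<^sub>R (z - Z i), -1)"
    using a by (simp add: algebra_simps scaleR_diff_right)
  ultimately show ?thesis by (simp add: a_def)
qed

text \<open>With the copies frozen, only smooth terms depend on \<open>z\<close>, so the Fermat rule
  on \<open>K\<close> applies directly.\<close>

lemma penalty_min_normal: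
  fixes \<phi> p :: "'s::finite \<Rightarrow> 'a::euclidean_space \<Rightarrow> real"
  assumes k: "0 < k" and z: "z \<in> K" "z \<in> ball xb r"
    and der: "\<And>i. (p i has_derivative (\<lambda>h. inner (G i) h)) (at z)"
    and min: "\<And>x. x \<in> K \<inter> cball xb r \<Longrightarrow> penalty \<phi> p c xb k z Z \<le> penalty \<phi> p c xb k x Z"
  shows "- ((\<Sum>i\<in>UNIV. softmax k (\<lambda>i. \<phi> i (Z i) + p i z - c i) i *\<^sub>R G i + (2 * k) *\<^sub>R (z - Z i))
      + 2 *\<^sub>R (z - xb)) \<in> regular_normal_cone z K"
proof (rule neg_gradient_regular_normal)
  let ?a = "softmax k (\<lambda>i. \<phi> i (Z i) + p i z - c i)"
  have "((\<lambda>x. penalty \<phi> p c xb k x Z) has_derivative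
      (\<lambda>h. (\<Sum>i\<in>UNIV. ?a i * inner (G i) h) + k * (\<Sum>i\<in>UNIV. 2 * inner (z - Z i) h) + 2 * inner (z - xb) h))
      (at z)"
    unfolding penalty_def
  proof (intro has_derivative_add has_derivative_mult_right has_derivative_sum)
    have "((\<lambda>x. \<phi> i (Z i) + p i x - c i) has_derivative (\<lambda>h. inner (G i) h)) (at z)" for i
      by (auto intro!: derivative_eq_intros der)
    then show "((\<lambda>x. lse k (\<lambda>i. \<phi> i (Z i) + p i x - c i)) has_derivative
        (\<lambda>h. \<Sum>i\<in>UNIV. ?a i * inner (G i) h)) (at z)"
      using k by (intro has_derivative_lse) auto
    have "((\<lambda>x. (norm (x - y))\<^sup>2) has_derivative (\<lambda>h. 2 * inner (z - y) h)) (at z)" for y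
      unfolding power2_norm_eq_inner
      by (auto intro!: derivative_eq_intros simp: fun_eq_iff inner_commute)
    then show "((\<lambda>x. (norm (x - Z i))\<^sup>2) has_derivative (\<lambda>h. 2 * inner (z - Z i) h)) (at z)"
        "((\<lambda>x. (norm (x - xb))\<^sup>2) has_derivative (\<lambda>h. 2 * inner (z - xb) h)) (at z)" for i
      by blast+
  qed
  moreover have "(\<Sum>i\<in>UNIV. ?a i * inner (G i) h) + k * (\<Sum>i\<in>UNIV. 2 * inner (z - Z i) h) + 2 * inner (z - xb) h =
      inner ((\<Sum>i\<in>UNIV. ?a i *\<^sub>R G i + (2 * k) *\<^sub>R (z - Z i)) + 2 *\<^sub>R (z - xb)) h" for h
    by (simp add: inner_sum_left inner_add_left sum.distrib sum_distrib_left mult_ac)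
  ultimately show "((\<lambda>x. penalty \<phi> p c xb k x Z) has_derivative
      (\<lambda>h. inner ((\<Sum>i\<in>UNIV. ?a i *\<^sub>R G i + (2 * k) *\<^sub>R (z - Z i)) + 2 *\<^sub>R (z - xb)) h)) (at z)"
    by simp
  have "\<forall>\<^sub>F x in at z within K. x \<in> ball xb r"
    by (rule topological_tendstoD[OF tendsto_ident_at]) (use z in auto)
  moreover have "\<forall>\<^sub>F x in at z within K. x \<in> K"
    by (simp add: eventually_at_filter)
  ultimately show "\<forall>\<^sub>F x in at z within K. penalty \<phi> p c xb k z Z \<le> penalty \<phi> p c xb k x Z"
    by eventually_elim (auto intro!: min)
qed (fact z)

subsection \<open>Multiplier rule\<close>

text \<open>By \<open>upper\<close> and \<open>lower\<close>, \<open>xb\<close> minimises the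
  maximum of \<open>\<phi> i + p i - c i\<close> over \<open>K\<close>, with value 0. Minimisers of
  the penalised problem are close to \<open>xb\<close> for large \<open>k\<close>; stationarity in
  the copies yields the subgradients, stationarity in \<open>z\<close> the normal.\<close>

lemma fuzzy_multiplier_rule:
  fixes \<phi> p :: "'s::finite \<Rightarrow> 'a::euclidean_space \<Rightarrow> real"
  assumes K: "closed K" "xb \<in> K" and r: "0 < r"
    and lip: "\<And>i. L-lipschitz_on (cball xb r) (\<phi> i)"
    and der: "\<And>i z. (p i has_derivative (\<lambda>h. inner (G i z) h)) (at z)"
    and upper: "\<And>i. \<phi> i xb + p i xb \<le> c i"
    and lower: "\<And>x. x \<in> K \<Longrightarrow> \<exists>i. c i \<le> \<phi> i x + p i x"
    and e: "0 < e"
  obtains a z Z v where "dist z xb < e" "\<And>i. dist (Z i) xb < e"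
    "\<And>i. 0 < a i" "(\<Sum>i\<in>UNIV. a i) = 1" "\<And>i. norm (v i) \<le> L"
    "\<And>i. (v i, -1) \<in> regular_normal_cone (Z i, \<phi> i (Z i)) (epigraph UNIV (\<phi> i))"
    "- ((\<Sum>i\<in>UNIV. a i *\<^sub>R (G i z + v i)) + 2 *\<^sub>R (z - xb)) \<in> regular_normal_cone z K"
proof -
  let ?B = "cball xb r"
  \<comment> \<open>\<open>Z i\<close> is reached from \<open>xb\<close> through \<open>z\<close> in
    two legs shorter than \<open>d\<close>, so \<open>2 * d\<close> must not exceed \<open>e\<close>
    or \<open>r\<close>.\<close>
  define d where "d = min e r / 2"
  have d: "0 < d" "2 * d \<le> e" "2 * d \<le> r" using e r by (auto simp: d_def)
  define C where "C = ln (real CARD('s)) + L\<^sup>2 / 2"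
  have "1 \<le> real CARD('s)" using zero_less_card_finite[where 'a = 's] by linarith
  then have C: "0 \<le> C" by (simp add: C_def)
  \<comment> \<open>Large enough for the bound \<open>C / k\<close> on the squared distances to drop
    below the square of \<open>d\<close>.\<close>
  define k where "k = max 2 (C / d\<^sup>2 + 1)"
  have k: "2 \<le> k" "C / d\<^sup>2 < k" by (auto simp: k_def)
  have Ck: "C / k < d\<^sup>2" using k d by (simp add: divide_simps) (simp add: mult_ac)
  have "continuous_on ?B (\<phi> i)" "continuous_on UNIV (p i)" for i
    using lip lipschitz_on_continuous_on der has_derivative_continuous
    by (blast, metis continuous_at_imp_continuous_on)
  then obtain z Z where z: "z \<in> K \<inter> ?B" and Z: "\<And>i. Z i \<in> ?B"
    and min: "\<And>z' Z'. z' \<in> K \<inter> ?B \<Longrightarrow> (\<And>i. Z' i \<in> ?B) \<Longrightarrow>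
      penalty \<phi> p c xb k z Z \<le> penalty \<phi> p c xb k z' Z'"
    using penalty_minimizer_exists[of K xb r \<phi> p k c] K r k by (metis less_imp_le not_numeral_le_zero)
  have "penalty \<phi> p c xb k z Z \<le> penalty \<phi> p c xb k xb (\<lambda>_. xb)"
    using K r by (intro min) auto
  note bounds = penalty_sublevel_le[where \<phi> = \<phi> and p = p and c = c and r = r,
      OF lip upper lower _ Z this k(1), folded C_def]
  have "(norm (z - xb))\<^sup>2 < d\<^sup>2" "(norm (z - Z i))\<^sup>2 < d\<^sup>2" for i
    using le_less_trans[OF bounds(1) Ck] le_less_trans[OF bounds(2) Ck] z by auto
  then have near: "norm (z - xb) < d" "norm (z - Z i) < d" for i
    using d by (auto intro: power2_less_imp_less)
  have zd: "dist z xb < 2 * d" using near d by (simp add: dist_norm)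
  have Zd: "dist (Z i) xb < 2 * d" for i
    using dist_triangle[of "Z i" xb z] near(1) near(2)[of i] by (simp add: dist_norm norm_minus_commute)
  define a where "a = softmax k (\<lambda>i. \<phi> i (Z i) + p i z - c i)"
  define v where "v = (\<lambda>i. (2 * k / a i) *\<^sub>R (z - Z i))"
  have a: "0 < a i" for i by (simp add: a_def softmax_pos)
  have v: "(v i, -1) \<in> regular_normal_cone (Z i, \<phi> i (Z i)) (epigraph UNIV (\<phi> i))" for i
    unfolding v_def a_def
  proof (rule penalty_min_subgradient)
    show "Z i \<in> ball xb r" using Zd[of i] d by (simp add: dist_commute)
  qed (use k z Z in \<open>auto intro!: min\<close>)
  have "norm (v i) \<le> L" for i
  proof (rule norm_regular_subgradient_le[OF v])
    have "cball (Z i) (r - dist (Z i) xb) \<subseteq> ?B"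
      by (simp add: cball_subset_cball_iff)
    then show "L-lipschitz_on (cball (Z i) (r - dist (Z i) xb)) (\<phi> i)"
      using lip lipschitz_on_subset by blast
    show "0 < r - dist (Z i) xb" using Zd[of i] d by simp
  qed
  moreover have "- ((\<Sum>i\<in>UNIV. a i *\<^sub>R G i z + (2 * k) *\<^sub>R (z - Z i)) + 2 *\<^sub>R (z - xb))
      \<in> regular_normal_cone z K"
    unfolding a_def
    by (rule penalty_min_normal[where r = r]) (use k z Z zd d in \<open>auto simp: dist_commute intro!: min der\<close>)
  \<comment> \<open>The coupling term \<open>(2 * k) *\<^sub>R (z - Z i)\<close> is
    \<open>a i *\<^sub>R v i\<close> by the choice of \<open>v\<close>.\<close>
  then have "- ((\<Sum>i\<in>UNIV. a i *\<^sub>R (G i z + v i)) + 2 *\<^sub>R (z - xb)) \<in> regular_normal_cone z K"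
    using a by (simp add: v_def scaleR_add_right less_imp_neq[symmetric])
  moreover have "dist z xb < e" "\<And>i. dist (Z i) xb < e"
    using zd Zd d by (auto intro: less_le_trans)
  moreover have "(\<Sum>i\<in>UNIV. a i) = 1" by (simp add: a_def sum_softmax)
  ultimately show thesis using that[of z Z a v] a v by blast
qed

text \<open>Limit of the fuzzy rule at points tending to \<open>xb\<close>. The weights lie in [0,1]
  and the regular subgradients are bounded by \<open>L\<close>, so a subsequence converges; limiting
  subgradients result even at indices whose weight tends to 0.\<close>

lemma multiplier_rule:
  fixes \<phi> p :: "'s::finite \<Rightarrow> 'a::euclidean_space \<Rightarrow> real"
  assumes K: "closed K" "xb \<in> K" and r: "0 < r"
    and lip: "\<And>i. L-lipschitz_on (cball xb r) (\<phi> i)"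
    and der: "\<And>i z. (p i has_derivative (\<lambda>h. inner (G i z) h)) (at z)"
    and G: "\<And>i. isCont (G i) xb"
    and upper: "\<And>i. \<phi> i xb + p i xb \<le> c i"
    and lower: "\<And>x. x \<in> K \<Longrightarrow> \<exists>i. c i \<le> \<phi> i x + p i x"
  obtains a v where "\<And>i. 0 \<le> a i" "(\<Sum>i\<in>UNIV. a i) = 1"
    "\<And>i. v i \<in> limiting_subdiff (\<phi> i) xb"
    "- (\<Sum>i\<in>UNIV. a i *\<^sub>R (G i xb + v i)) \<in> limiting_normal_cone xb K"
proof -
  define P where "P = (\<lambda>(n::nat) a z (Z :: 's \<Rightarrow> 'a) v.
    dist z xb < inverse (Suc n) \<and> (\<forall>i. dist (Z i) xb < inverse (Suc n)) \<and>
    (\<forall>i. 0 < a i) \<and> (\<Sum>i\<in>UNIV. a i) = 1 \<and> (\<forall>i. norm (v i) \<le> L) \<and>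
    (\<forall>i. (v i, -1) \<in> regular_normal_cone (Z i, \<phi> i (Z i)) (epigraph UNIV (\<phi> i))) \<and>
    - ((\<Sum>i\<in>UNIV. a i *\<^sub>R (G i z + v i)) + 2 *\<^sub>R (z - xb)) \<in> regular_normal_cone z K)"
  have "\<exists>a z Z v. P n a z Z v" for n
  proof -
    have pos: "0 < inverse (real (Suc n))" by simp
    show ?thesis
    proof (rule fuzzy_multiplier_rule[where c = c, OF K r lip der upper _ pos])
      fix z Z a v
      assume "dist z xb < inverse (Suc n)" "\<And>i. dist (Z i) xb < inverse (Suc n)"
        "\<And>i. 0 < a i" "(\<Sum>i\<in>UNIV. a i) = 1" "\<And>i. norm (v i) \<le> L"
        "\<And>i. (v i, -1) \<in> regular_normal_cone (Z i, \<phi> i (Z i)) (epigraph UNIV (\<phi> i))"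
        "- ((\<Sum>i\<in>UNIV. a i *\<^sub>R (G i z + v i)) + 2 *\<^sub>R (z - xb)) \<in> regular_normal_cone z K"
      then have "P n a z Z v" unfolding P_def by blast
      then show ?thesis by blast
    qed (rule lower)
  qed
  then obtain a z Z v where "\<And>n. P n (a n) (z n) (Z n) (v n)" by metis
  then have z: "\<And>n. dist (z n) xb < inverse (Suc n)" and Z: "\<And>n i. dist (Z n i) xb < inverse (Suc n)"
    and a: "\<And>n i. 0 < a n i" "\<And>n. (\<Sum>i\<in>UNIV. a n i) = 1" and v: "\<And>n i. norm (v n i) \<le> L"
    and sub: "\<And>n i. (v n i, -1) \<in> regular_normal_cone (Z n i, \<phi> i (Z n i)) (epigraph UNIV (\<phi> i))"
    and nor: "\<And>n. - ((\<Sum>i\<in>UNIV. a n i *\<^sub>R (G i (z n) + v n i)) + 2 *\<^sub>R (z n - xb))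
      \<in> regular_normal_cone (z n) K"
    by (auto simp: P_def)
  have a1: "a n i \<le> 1" for n i
    using member_le_sum[of i UNIV "a n"] a by (simp add: less_imp_le)
  \<comment> \<open>Collecting all weights and subgradients in one vector yields a common
    subsequence by a single extraction.\<close>
  define w where "w = (\<lambda>n. ((\<chi> i. a n i) :: real ^ 's, (\<chi> i. v n i) :: 'a ^ 's))"
  have "norm (w n) \<le> norm ((\<chi> i. 1) :: real ^ 's) + norm ((\<chi> i. L) :: real ^ 's)" for n
  proof -
    have "norm (w n) \<le> norm (fst (w n)) + norm (snd (w n))"
      by (metis norm_Pair_le prod.collapse)
    also have "norm (fst (w n)) \<le> norm ((\<chi> i. 1) :: real ^ 's)"
      using a a1 by (intro norm_le_componentwise_cart) (auto simp: w_def less_imp_le)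
    also have "norm (snd (w n)) \<le> norm ((\<chi> i. L) :: real ^ 's)"
      by (intro norm_le_componentwise_cart) (auto simp: w_def intro!: order_trans[OF v abs_ge_self])
    finally show ?thesis by simp
  qed
  then have "bounded (range w)" by (intro boundedI) auto
  then obtain l s where s: "strict_mono s" and l: "(w \<circ> s) \<longlonglongrightarrow> l"
    using bounded_imp_convergent_subsequence by blast
  have al: "(\<lambda>n. a (s n) i) \<longlonglongrightarrow> fst l $ i" and vl: "(\<lambda>n. v (s n) i) \<longlonglongrightarrow> snd l $ i" for i
    using tendsto_vec_nth[OF tendsto_fst[OF l], of i] tendsto_vec_nth[OF tendsto_snd[OF l], of i]
    by (simp_all add: w_def)
  have inv: "(\<lambda>n. inverse (real (Suc (s n)))) \<longlonglongrightarrow> 0"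
    using LIMSEQ_subseq_LIMSEQ[OF LIMSEQ_inverse_real_of_nat s] by (simp add: o_def)
  have zl: "(\<lambda>n. z (s n)) \<longlonglongrightarrow> xb" and Zl: "(\<lambda>n. Z (s n) i) \<longlonglongrightarrow> xb" for i
    by (rule tendsto_dist_iff[THEN iffD2, OF tendsto_sandwich[OF _ _ tendsto_const inv]];
        intro always_eventually allI zero_le_dist less_imp_le z Z)+
  show thesis
  proof (rule that[of "\<lambda>i. fst l $ i" "\<lambda>i. snd l $ i"])
    show "0 \<le> fst l $ i" for i
      by (rule LIMSEQ_le_const[OF al]) (auto intro: less_imp_le a)
    have "(\<lambda>n. \<Sum>i\<in>UNIV. a (s n) i) \<longlonglongrightarrow> (\<Sum>i\<in>UNIV. fst l $ i)"
      by (intro tendsto_sum al)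
    then show "(\<Sum>i\<in>UNIV. fst l $ i) = 1"
      using a(2) by (simp add: LIMSEQ_const_iff)
    show "snd l $ i \<in> limiting_subdiff (\<phi> i) xb" for i
      unfolding limiting_subdiff_def mem_Collect_eq
    proof (rule limiting_normal_coneI[OF _ sub[of "s n" for n]])
      have "isCont (\<phi> i) xb"
        using lipschitz_on_continuous_on[OF lip] r
        by (intro continuous_on_interior[of "cball xb r"]) auto
      then show "(\<lambda>n. (Z (s n) i, \<phi> i (Z (s n) i))) \<longlonglongrightarrow> (xb, \<phi> i xb)"
        by (intro tendsto_Pair isCont_tendsto_compose[where g = "\<phi> i"] Zl)
      show "(\<lambda>n. (v (s n) i, - 1)) \<longlonglongrightarrow> (snd l $ i, - 1)"
        by (intro tendsto_intros vl)
    qed (simp add: mem_epigraph)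
    have "(\<lambda>n. - ((\<Sum>i\<in>UNIV. a (s n) i *\<^sub>R (G i (z (s n)) + v (s n) i)) + 2 *\<^sub>R (z (s n) - xb))) \<longlonglongrightarrow>
        - ((\<Sum>i\<in>UNIV. fst l $ i *\<^sub>R (G i xb + snd l $ i)) + 2 *\<^sub>R (xb - xb))"
      by (intro tendsto_intros al vl zl isCont_tendsto_compose[OF G zl])
    then show "- (\<Sum>i\<in>UNIV. fst l $ i *\<^sub>R (G i xb + snd l $ i)) \<in> limiting_normal_cone xb K"
      by (intro limiting_normal_coneI[OF K(2) nor[of "s n" for n] zl]) simp
  qed
qed

section \<open>Components and continuity of locally Lipschitz maps\<close>

lemma locally_lipschitz_component:
  fixes f :: "'a::metric_space \<Rightarrow> real ^ 's"
  assumes "locally_lipschitz f"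
  obtains r L where "0 < r" "\<And>i. L-lipschitz_on (cball x r) (\<lambda>z. f z $ i)"
proof -
  obtain r L where "0 < r" and L: "L-lipschitz_on (cball x r) f"
    using assms unfolding locally_lipschitz_def by blast
  moreover have "L-lipschitz_on (cball x r) (\<lambda>z. f z $ i)" for i
  proof (rule lipschitz_onI)
    show "dist (f y $ i) (f z $ i) \<le> L * dist y z" if "y \<in> cball x r" "z \<in> cball x r" for y z
      using lipschitz_onD[OF L that] dist_vec_nth_le[of "f y" i "f z"] by linarith
  qed (rule lipschitz_on_nonneg[OF L])
  ultimately show thesis using that by blast
qed

lemma locally_lipschitz_continuous:
  assumes "locally_lipschitz f"
  shows "continuous_on UNIV f"
proof (rule continuous_at_imp_continuous_on, rule ballI)
  fix x
  obtain r L where r: "0 < r" and L: "L-lipschitz_on (cball x r) f"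
    using assms unfolding locally_lipschitz_def by blast
  have "ball x r \<subseteq> cball x r" by auto
  then have "continuous_on (ball x r) f"
    using lipschitz_on_continuous_on[OF L] continuous_on_subset by blast
  then show "isCont f x" using r by (simp add: continuous_on_eq_continuous_at)
qed


subsection \<open>The Rabier function and the tangency variety\<close>

lemma rabier_nonneg: "0 \<le> rabier f K x"
  unfolding rabier_def by (rule Inf_greatest) auto

lemma rabier_le:
  assumes "\<And>i. v i \<in> limiting_subdiff (\<lambda>z. f z $ i) x" "\<omega> \<in> limiting_normal_cone x K"
    "\<And>i. 0 \<le> a i" "(\<Sum>i\<in>UNIV. a i) = 1"
  shows "rabier f K x \<le> ereal (norm ((\<Sum>i\<in>UNIV. a i *\<^sub>R v i) + \<omega>))"
  unfolding rabier_def
  by (rule Inf_lower) (use assms in \<open>auto intro!: exI[of _ v] exI[of _ \<omega>] exI[of _ "\<chi> i. a i"]\<close>)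

text \<open>With \<open>p = 0\<close> and \<open>c i = f x $ i\<close>, weak efficiency is the
  hypothesis \<open>lower\<close> of the multiplier rule. The resulting normal cancels the
  combination of subgradients.\<close>

lemma weak_pareto_efficient_rabier:
  fixes f :: "real ^ 'n \<Rightarrow> real ^ 's"
  assumes "locally_lipschitz f" "closed K" "weak_pareto_efficient K f x"
  shows "rabier f K x = 0"
proof -
  obtain r L where r: "0 < r" and L: "\<And>i. L-lipschitz_on (cball x r) (\<lambda>z. f z $ i)"
    using locally_lipschitz_component[OF assms(1)] by blast
  have x: "x \<in> K" "\<And>z. z \<in> K \<Longrightarrow> \<exists>i. f x $ i \<le> f z $ i + 0"
    using assms(3) by (auto simp: weak_pareto_efficient_def not_less)
  obtain a v where av: "\<And>i. 0 \<le> a i" "(\<Sum>i\<in>UNIV. a i) = 1"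
      "\<And>i. v i \<in> limiting_subdiff (\<lambda>z. f z $ i) x"
      "- (\<Sum>i\<in>UNIV. a i *\<^sub>R (0 + v i)) \<in> limiting_normal_cone x K"
    by (rule multiplier_rule[of K x r L "\<lambda>i z. f z $ i" "\<lambda>_ _. 0" "\<lambda>_ _. 0" "\<lambda>i. f x $ i"])
      (use assms(2) r L x in auto)
  have "rabier f K x \<le> ereal (norm ((\<Sum>i\<in>UNIV. a i *\<^sub>R v i) + - (\<Sum>i\<in>UNIV. a i *\<^sub>R (0 + v i))))"
    by (rule rabier_le[OF av(3,4,1,2)])
  then show ?thesis using rabier_nonneg[of f K x] by (simp add: zero_ereal_def)
qed

lemma has_derivative_ln_norm:
  fixes x :: "'a::real_inner"
  shows "((\<lambda>z. d * ln (1 + (norm z)\<^sup>2)) has_derivative (\<lambda>h. inner ((2 * d / (1 + (norm x)\<^sup>2)) *\<^sub>R x) h)) (at x)"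
proof -
  have pos: "0 < 1 + inner x x"
    by (simp add: add_pos_nonneg)
  have "((\<lambda>z. 1 + inner z z) has_derivative (\<lambda>h. 2 * inner x h)) (at x)"
    by (auto intro!: derivative_eq_intros simp: fun_eq_iff inner_commute)
  then have "((\<lambda>z. ln (1 + inner z z)) has_derivative (\<lambda>h. 2 * inner x h * inverse (1 + inner x x))) (at x)"
    by (intro has_derivative_ln pos)
  then have "((\<lambda>z. d * ln (1 + inner z z)) has_derivative
      (\<lambda>h. d * (2 * inner x h * inverse (1 + inner x x)))) (at x)"
    by (rule has_derivative_mult_right)
  then show ?thesis
    by (simp add: power2_norm_eq_inner divide_inverse mult_ac)
qed

text \<open>One application of the multiplier rule gives both claims: the constraints of
  \<open>S\<close> are treated as further objectives with levels \<open>y0\<close>, and the radial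
  gradient of the penalty supplies the multiple of \<open>x\<close>.\<close>

lemma log_penalized_minimizer_tangency:
  fixes f :: "real ^ 'n \<Rightarrow> real ^ 's"
  assumes lip: "locally_lipschitz f" and "closed K" and d: "0 \<le> d"
    and S: "S = {x \<in> K. \<forall>i. i \<noteq> j \<longrightarrow> f x $ i \<le> y0 $ i}" and x: "x \<in> S"
    and min: "\<And>z. z \<in> S \<Longrightarrow> f x $ j + d * ln (1 + (norm x)\<^sup>2) \<le> f z $ j + d * ln (1 + (norm z)\<^sup>2)"
  shows "x \<in> tangency_variety f K" and "ereal (norm x) * rabier f K x \<le> ereal (2 * d)"
proof -
  define p where "p = (\<lambda>i (z :: real ^ 'n). if i = j then d * ln (1 + (norm z)\<^sup>2) else 0)"
  define G where "G = (\<lambda>i (z :: real ^ 'n). if i = j then (2 * d / (1 + (norm z)\<^sup>2)) *\<^sub>R z else 0)"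
  define c where "c = (\<lambda>i. if i = j then f x $ j + d * ln (1 + (norm x)\<^sup>2) else y0 $ i)"
  have xK: "x \<in> K" using x by (simp add: S)
  obtain r L where r: "0 < r" and L: "\<And>i. L-lipschitz_on (cball x r) (\<lambda>z. f z $ i)"
    using locally_lipschitz_component[OF lip] by blast
  have der: "(p i has_derivative (\<lambda>h. inner (G i z) h)) (at z)" for i z
    using has_derivative_ln_norm[of d z] by (cases "i = j") (simp_all add: p_def G_def)
  have pos: "0 < 1 + (norm z)\<^sup>2" for z :: "real ^ 'n"
    by (simp add: add_pos_nonneg)
  have cont: "isCont (G i) x" for i
    unfolding G_def using pos[of x] by (cases "i = j") (auto intro!: continuous_intros)
  have upper: "f x $ i + p i x \<le> c i" for i
    using x by (auto simp: p_def c_def S)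
  \<comment> \<open>A point of \<open>K\<close> strictly below all levels would lie in
    \<open>S\<close> and have a smaller penalised value than \<open>x\<close>.\<close>
  have lower: "\<exists>i. c i \<le> f z $ i + p i z" if "z \<in> K" for z
  proof (rule ccontr)
    assume "\<nexists>i. c i \<le> f z $ i + p i z"
    then have less: "\<And>i. f z $ i + p i z < c i" by (auto simp: not_le)
    have "f z $ i \<le> y0 $ i" if "i \<noteq> j" for i
      using less[of i] that by (simp add: p_def c_def)
    then have "z \<in> S" using that by (simp add: S)
    then show False using min less[of j] by (auto simp: p_def c_def not_le[symmetric])
  qed
  obtain a v where a: "\<And>i. 0 \<le> a i" "(\<Sum>i\<in>UNIV. a i) = 1"
    and v: "\<And>i. v i \<in> limiting_subdiff (\<lambda>z. f z $ i) x"
    and N: "- (\<Sum>i\<in>UNIV. a i *\<^sub>R (G i x + v i)) \<in> limiting_normal_cone x K"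
    by (rule multiplier_rule[of K x r L "\<lambda>i z. f z $ i" p G c])
      (use assms(2) xK r L der cont upper lower in auto)
  define \<omega> where "\<omega> = - (\<Sum>i\<in>UNIV. a i *\<^sub>R (G i x + v i))"
  define \<mu> where "\<mu> = a j * (2 * d / (1 + (norm x)\<^sup>2))"
  have \<mu>: "0 \<le> \<mu>" using a(1) d pos[of x] by (simp add: \<mu>_def)
  have aj: "a j \<le> 1" using member_le_sum[of j UNIV a] a by simp
  have "(\<Sum>i\<in>UNIV. a i *\<^sub>R G i x) = \<mu> *\<^sub>R x"
    by (simp add: G_def \<mu>_def if_distrib cong: if_cong)
  then have eq: "(\<Sum>i\<in>UNIV. a i *\<^sub>R v i) + \<omega> = - (\<mu> *\<^sub>R x)"
    by (simp add: \<omega>_def scaleR_add_right sum.distrib)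
  have "rabier f K x \<le> ereal (norm ((\<Sum>i\<in>UNIV. a i *\<^sub>R v i) + \<omega>))"
    using N by (intro rabier_le v a) (simp add: \<omega>_def)
  then have "ereal (norm x) * rabier f K x \<le> ereal (norm x) * ereal (\<mu> * norm x)"
    using \<mu> by (intro ereal_mult_left_mono) (auto simp: eq)
  also have "\<dots> \<le> ereal (2 * d)"
  proof -
    \<comment> \<open>The quotient of the squared norm by one plus itself is at most 1; this is how
      the logarithm controls the Rabier function even after multiplication by the norm.\<close>
    have "norm x * (\<mu> * norm x) = a j * (2 * d * ((norm x)\<^sup>2 / (1 + (norm x)\<^sup>2)))"
      by (simp add: \<mu>_def power2_eq_square)
    also have "\<dots> \<le> 1 * (2 * d * 1)"
      using pos[of x] aj a(1) d by (intro mult_mono) auto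
    finally show ?thesis by simp
  qed
  finally show "ereal (norm x) * rabier f K x \<le> ereal (2 * d)" .
  \<comment> \<open>Rescaling by \<open>t\<close> restores the normalisation in the tangency
    variety; the cone property absorbs the factor on \<open>\<omega>\<close>.\<close>
  define t where "t = 1 / (1 + \<mu>)"
  have t: "0 < t" "t + t * \<mu> = 1" using \<mu> by (simp_all add: t_def field_simps)
  have "t *\<^sub>R \<omega> \<in> limiting_normal_cone x K"
    using N t by (intro limiting_normal_cone_scaleR) (auto simp: \<omega>_def)
  moreover have "(\<Sum>i\<in>UNIV. t * a i) + \<bar>t * \<mu>\<bar> = 1"
    using a(2) t \<mu> by (simp flip: sum_distrib_left)
  moreover have "0 = (\<Sum>i\<in>UNIV. (t * a i) *\<^sub>R v i) + (t * \<mu>) *\<^sub>R x + t *\<^sub>R \<omega>"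
  proof -
    have "(\<Sum>i\<in>UNIV. (t * a i) *\<^sub>R v i) + t *\<^sub>R \<omega> = t *\<^sub>R ((\<Sum>i\<in>UNIV. a i *\<^sub>R v i) + \<omega>)"
      by (simp add: scaleR_add_right scaleR_sum_right)
    also have "\<dots> = - ((t * \<mu>) *\<^sub>R x)" by (simp add: eq)
    finally show ?thesis by (simp only: eq_neg_iff_add_eq_0 add_ac)
  qed
  ultimately show "x \<in> tangency_variety f K"
    unfolding tangency_variety_def using xK v a(1) t
    by (auto intro!: exI[of _ v] exI[of _ "\<chi> i. t * a i"] exI[of _ "t * \<mu>"] bexI[of _ "t *\<^sub>R \<omega>"])
qed


subsection \<open>Minimising sequences\<close>

text \<open>The logarithm is coercive and \<open>g\<close> is bounded below by \<open>m\<close>, so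
  points outside a large ball lose to \<open>x0\<close>, and inside the ball compactness
  applies.\<close>

lemma log_penalized_minimizer_exists:
  fixes g :: "'a::euclidean_space \<Rightarrow> real"
  assumes "closed S" "x0 \<in> S" "continuous_on S g" and m: "\<And>x. x \<in> S \<Longrightarrow> m \<le> g x" and d: "0 < d"
  obtains x where "x \<in> S"
    "\<And>z. z \<in> S \<Longrightarrow> g x + d * ln (1 + (norm x)\<^sup>2) \<le> g z + d * ln (1 + (norm z)\<^sup>2)"
proof -
  let ?F = "\<lambda>z. g z + d * ln (1 + (norm z)\<^sup>2)"
  \<comment> \<open>Once the logarithm exceeds \<open>q\<close>, the penalty outweighs the gap
    between the penalised value at \<open>x0\<close> and \<open>m\<close>; this happens for norms
    above \<open>R\<close>.\<close>
  define q where "q = (?F x0 - m) / d"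
  define R where "R = sqrt (exp q)"
  have pos: "0 < 1 + (norm z)\<^sup>2" for z :: 'a by (simp add: add_pos_nonneg)
  have far: "?F x0 < ?F z" if "z \<in> S" "R < norm z" for z
  proof -
    have "exp q = R\<^sup>2" by (simp add: R_def)
    also have "\<dots> \<le> (norm z)\<^sup>2" using that by (intro power_mono) (auto simp: R_def)
    also have "\<dots> < 1 + (norm z)\<^sup>2" by simp
    finally have "ln (exp q) < ln (1 + (norm z)\<^sup>2)" using pos[of z] by (subst ln_less_cancel_iff) auto
    then have "q < ln (1 + (norm z)\<^sup>2)" by simp
    then have "?F x0 - m < d * ln (1 + (norm z)\<^sup>2)" using d by (simp add: q_def field_simps)
    then show ?thesis using m[OF that(1)] by linarith
  qed
  have "compact (S \<inter> cball 0 R)" using assms(1) by (intro closed_Int_compact compact_cball)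
  moreover have x0: "x0 \<in> S \<inter> cball 0 R" using far[of x0] assms(2) by (auto simp: not_less[symmetric])
  moreover have "continuous_on (S \<inter> cball 0 R) ?F"
    using pos by (intro continuous_intros continuous_on_subset[OF assms(3)]) (auto simp: less_imp_neq[symmetric])
  ultimately obtain x where x: "x \<in> S \<inter> cball 0 R" "\<And>z. z \<in> S \<inter> cball 0 R \<Longrightarrow> ?F x \<le> ?F z"
    using continuous_attains_inf[of "S \<inter> cball 0 R" ?F] by blast
  have "?F x \<le> ?F z" if "z \<in> S" for z
  proof (cases "norm z \<le> R")
    case True
    then show ?thesis using x(2)[of z] that by simp
  next
    case False
    then show ?thesis using x(2)[OF x0] far[of z] that by simp
  qed
  then show thesis using that x by blast
qed

text \<open>For a fixed competitor the penalty of weight \<open>inverse (Suc n)\<close> fades, so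
  \<open>g (x n)\<close> eventually drops below any number above a value of \<open>g\<close> on
  \<open>S\<close>. This gives convergence to the infimum, and also escape to infinity, as the
  minimum of \<open>g\<close> on a bounded piece of \<open>S\<close> is undercut elsewhere in
  \<open>S\<close>.\<close>

lemma unattained_inf_sequence:
  fixes g :: "'a::euclidean_space \<Rightarrow> real"
  assumes S: "closed S" "x0 \<in> S" and g: "continuous_on S g" and m: "\<And>x. x \<in> S \<Longrightarrow> m \<le> g x"
    and unattained: "\<And>x. x \<in> S \<Longrightarrow> \<exists>z\<in>S. g z < g x"
  obtains x :: "nat \<Rightarrow> 'a" where "\<And>n. x n \<in> S"
    "\<And>n z. z \<in> S \<Longrightarrow> g (x n) + inverse (Suc n) * ln (1 + (norm (x n))\<^sup>2)
      \<le> g z + inverse (Suc n) * ln (1 + (norm z)\<^sup>2)"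
    "(\<lambda>n. g (x n)) \<longlonglongrightarrow> Inf (g ` S)" "filterlim (\<lambda>n. norm (x n)) at_top sequentially"
proof -
  let ?p = "\<lambda>z :: 'a. ln (1 + (norm z)\<^sup>2)"
  have "\<exists>x. x \<in> S \<and> (\<forall>z\<in>S. g x + inverse (Suc n) * ?p x \<le> g z + inverse (Suc n) * ?p z)" for n
  proof -
    have pos: "0 < inverse (real (Suc n))" by simp
    obtain x where "x \<in> S" "\<And>z. z \<in> S \<Longrightarrow> g x + inverse (Suc n) * ?p x \<le> g z + inverse (Suc n) * ?p z"
      using log_penalized_minimizer_exists[OF S g m pos] by blast
    then show ?thesis by blast
  qed
  then obtain x where x: "\<And>n. x n \<in> S"
    and min: "\<And>n z. z \<in> S \<Longrightarrow> g (x n) + inverse (Suc n) * ?p (x n) \<le> g z + inverse (Suc n) * ?p z"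
    by metis
  have bdd: "bdd_below (g ` S)" using m by (rule bdd_belowI2)
  have ev: "\<forall>\<^sub>F n in sequentially. g (x n) < b" if b: "z \<in> S" "g z < b" for z b
  proof -
    have "(\<lambda>n. g z + inverse (Suc n) * ?p z) \<longlonglongrightarrow> g z + 0 * ?p z"
      by (intro tendsto_intros LIMSEQ_inverse_real_of_nat)
    then have "\<forall>\<^sub>F n in sequentially. g z + inverse (Suc n) * ?p z < b"
      by (rule order_tendstoD(2)) (use b in simp)
    then show ?thesis
    proof eventually_elim
      fix n assume "g z + inverse (Suc n) * ?p z < b"
      moreover have "0 \<le> inverse (Suc n) * ?p (x n)" by simp
      ultimately show "g (x n) < b" using min[OF b(1), of n] by linarith
    qed
  qed
  have "(\<lambda>n. g (x n)) \<longlonglongrightarrow> Inf (g ` S)"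
  proof (rule order_tendstoI)
    show "\<forall>\<^sub>F n in sequentially. b < g (x n)" if "b < Inf (g ` S)" for b
      using that x cInf_lower[OF _ bdd] by (auto intro!: always_eventually less_le_trans[OF that])
    show "\<forall>\<^sub>F n in sequentially. g (x n) < b" if "Inf (g ` S) < b" for b
      using that S cInf_less_iff[OF _ bdd, of b] ev by auto
  qed
  moreover have "filterlim (\<lambda>n. norm (x n)) at_top sequentially"
    unfolding filterlim_at_top
  proof
    fix R
    show "\<forall>\<^sub>F n in sequentially. R \<le> norm (x n)"
    proof (cases "S \<inter> cball 0 R = {}")
      case True
      then have "R \<le> norm (x n)" for n using x[of n] by (auto simp: disjoint_iff not_le less_imp_le)
      then show ?thesis by simp
    next
      case False
      moreover have "compact (S \<inter> cball 0 R)" using S by (intro closed_Int_compact compact_cball)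
      moreover have "continuous_on (S \<inter> cball 0 R) g" using g continuous_on_subset by blast
      ultimately obtain w where w: "w \<in> S" "\<And>z. z \<in> S \<inter> cball 0 R \<Longrightarrow> g w \<le> g z"
        using continuous_attains_inf[of "S \<inter> cball 0 R" g] by blast
      obtain z where "z \<in> S" "g z < g w" using unattained w by blast
      then have "\<forall>\<^sub>F n in sequentially. g (x n) < g w" by (rule ev)
      then show ?thesis
      proof eventually_elim
        fix n assume "g (x n) < g w"
        then have "x n \<notin> S \<inter> cball 0 R" using w(2)[of "x n"] by auto
        then show "R \<le> norm (x n)" using x[of n] by simp
      qed
    qed
  qed
  ultimately show thesis using that x min by blast
qed


subsection \<open>Asymptotic values without weakly efficient points\<close>

lemma tendsto_fun_componentwise:
  fixes x :: "'b \<Rightarrow> 'i \<Rightarrow> 'c::topological_space"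
  assumes "\<And>i. ((\<lambda>n. x n i) \<longlongrightarrow> l i) F"
  shows "(x \<longlongrightarrow> l) F"
proof -
  have "limitin (product_topology (\<lambda>i. euclidean) UNIV) x l F"
    using assms by (simp add: limitin_componentwise)
  then show ?thesis by (simp add: euclidean_product_topology)
qed

lemma section_atI: "x \<in> K \<Longrightarrow> f x \<le> f x0 \<Longrightarrow> x \<in> section_at K f x0"
  by (simp add: section_at_def less_eq_vec_def)

text \<open>Supplies the contradiction for sufficiency: one sequence meets the requirements of
  \<open>K_inf\<close> and \<open>T_inf\<close> at once, with a limit outside
  \<open>K_zero\<close>.\<close>

lemma no_weak_pareto_sequence:
  fixes f :: "real ^ 'n \<Rightarrow> real ^ 's"
  assumes lip: "locally_lipschitz f" and K: "closed K" and x0: "x0 \<in> K" and I: "I \<noteq> {}"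
    and wb: "weakly_section_bounded_below K f I x0" and no: "\<nexists>x. weak_pareto_efficient K f x"
  obtains y and x :: "nat \<Rightarrow> real ^ 'n" where "y \<in> Rvec I" "y \<notin> K_zero f K I (f x0)"
    "\<And>k. x k \<in> K \<and> f (x k) \<le> f x0" "filterlim (\<lambda>k. norm (x k)) at_top sequentially"
    "(\<lambda>k. subvec f I (x k)) \<longlonglongrightarrow> y" "\<And>k. x k \<in> tangency_variety f K"
    "(\<lambda>k. ereal (norm (x k)) * rabier f K (x k)) \<longlonglongrightarrow> 0"
proof -
  obtain j where j: "j \<in> I" using I by blast
  obtain a where "subvec f I ` section_at K f x0 \<subseteq> {y \<in> Rvec I. \<forall>i\<in>I. a i \<le> y i}"
    using wb unfolding weakly_section_bounded_below_def by blast
  then have a: "a i \<le> f x $ i" if "x \<in> K" "f x \<le> f x0" "i \<in> I" for x i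
    using section_atI[OF that(1,2)] that(3) by (auto simp: subvec_def)
  define g where "g = (\<lambda>x. f x $ j)"
  define S where "S = {x \<in> K. \<forall>i. i \<noteq> j \<longrightarrow> f x $ i \<le> f x0 $ i}"
  have cont: "continuous_on A (\<lambda>x. f x $ i)" for A i
    by (intro continuous_intros continuous_on_subset[OF locally_lipschitz_continuous[OF lip]]) auto
  have "S = K \<inter> (\<Inter>i\<in>- {j}. {x. f x $ i \<le> f x0 $ i})" by (auto simp: S_def)
  moreover have "closed (K \<inter> (\<Inter>i\<in>- {j}. {x. f x $ i \<le> f x0 $ i}))"
    by (intro closed_Int K closed_INT ballI closed_Collect_le cont continuous_on_const)
  ultimately have "closed S" by simp
  have S0: "x0 \<in> S" using x0 by (simp add: S_def)
  have in_section: "f x \<le> f x0" if "x \<in> S" "g x \<le> g x0" for x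
    using that by (auto simp: S_def g_def less_eq_vec_def)
  have lb: "min (a j) (g x0) \<le> g x" if "x \<in> S" for x
    \<comment> \<open>\<open>S\<close> does not restrict component \<open>j\<close>, so the section
      bound \<open>a j\<close> is available only when \<open>g x \<le> g x0\<close>; otherwise
      \<open>g x0\<close> is the bound.\<close>
    using a[of x j] in_section[of x] that j by (fastforce simp: S_def g_def min_le_iff_disj)
  \<comment> \<open>Without weak efficiency some point of \<open>K\<close> is strictly better in
    every component; it keeps the constraints of \<open>S\<close> and lowers
    \<open>g\<close>.\<close>
  have unattained: "\<exists>z\<in>S. g z < g x" if x: "x \<in> S" for x
  proof -
    have "\<not> weak_pareto_efficient K f x" "x \<in> K" using no x by (auto simp: S_def)
    then obtain z where "z \<in> K" and z: "\<And>i. f z $ i < f x $ i"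
      by (auto simp: weak_pareto_efficient_def)
    moreover have "f z $ i \<le> f x0 $ i" if "i \<noteq> j" for i
      using z[of i] x that by (auto simp: S_def intro: order_trans[OF less_imp_le])
    ultimately show ?thesis by (auto simp: S_def g_def)
  qed
  obtain x where x: "\<And>n. x n \<in> S"
    and min: "\<And>n z. z \<in> S \<Longrightarrow> g (x n) + inverse (Suc n) * ln (1 + (norm (x n))\<^sup>2)
      \<le> g z + inverse (Suc n) * ln (1 + (norm z)\<^sup>2)"
    and lim: "(\<lambda>n. g (x n)) \<longlonglongrightarrow> Inf (g ` S)"
    and inf: "filterlim (\<lambda>n. norm (x n)) at_top sequentially"
    using unattained_inf_sequence[OF \<open>closed S\<close> S0 _ lb unattained] cont unfolding g_def by blast
  have Inf_le: "Inf (g ` S) \<le> g z" if "z \<in> S" for z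
    using that lb by (intro cInf_lower bdd_belowI2) auto
  obtain z0 where "z0 \<in> S" "g z0 < g x0" using unattained[OF S0] by blast
  then have "Inf (g ` S) < g x0" using Inf_le by fastforce
  then obtain N where N: "\<And>n. N \<le> n \<Longrightarrow> g (x n) < g x0"
    using order_tendstoD(2)[OF lim] by (auto simp: eventually_sequentially)
  have xK: "x n \<in> K" for n using x[of n] by (simp add: S_def)
  have xle: "f (x n) \<le> f x0" if "N \<le> n" for n
    using in_section[OF x] N[OF that] by (simp add: less_imp_le)
  \<comment> \<open>Section-boundedness gives lower bounds only on \<open>I\<close>, so the other
    components are set to 0 to obtain a bounded sequence.\<close>
  define u where "u = (\<lambda>n. (\<chi> i. if i \<in> I then f (x (n + N)) $ i else 0) :: real ^ 's)"
  have "norm (u n) \<le> norm ((\<chi> i. \<bar>a i\<bar> + \<bar>f x0 $ i\<bar>) :: real ^ 's)" for n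
  proof (rule norm_le_componentwise_cart)
    fix i
    have "f (x (n + N)) $ i \<le> f x0 $ i" using xle[of "n + N"] by (simp add: less_eq_vec_def)
    moreover have "a i \<le> f (x (n + N)) $ i" if "i \<in> I" using a[OF xK xle that] by simp
    ultimately show "norm (u n $ i) \<le> norm (((\<chi> i. \<bar>a i\<bar> + \<bar>f x0 $ i\<bar>) :: real ^ 's) $ i)"
      by (auto simp: u_def)
  qed
  then have "bounded (range u)" by (intro boundedI) auto
  then obtain l s where s: "strict_mono s" and l: "(u \<circ> s) \<longlonglongrightarrow> l"
    using bounded_imp_convergent_subsequence by blast
  \<comment> \<open>The shift by \<open>N\<close> drops the initial terms that might lie outside the
    section at \<open>x0\<close>.\<close>
  define t where "t = (\<lambda>n. s n + N)"
  have t: "strict_mono t" using s by (simp add: t_def strict_mono_def)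
  have f_lim: "(\<lambda>n. f (x (t n)) $ i) \<longlonglongrightarrow> l $ i" if "i \<in> I" for i
    using tendsto_vec_nth[OF l, of i] that by (simp add: u_def t_def)
  have xt: "f (x (t n)) \<le> f x0" for n by (rule xle) (simp add: t_def)
  define y where "y = (\<lambda>i\<in>I. l $ i)"
  show thesis
  proof (rule that[of y "x \<circ> t"])
    show "y \<in> Rvec I" by (simp add: y_def Rvec_def)
    \<comment> \<open>A point of the section realising \<open>y\<close> would attain the infimum of
      \<open>g\<close> on \<open>S\<close>.\<close>
    show "y \<notin> K_zero f K I (f x0)"
    proof
      assume "y \<in> K_zero f K I (f x0)"
      then obtain z where z: "z \<in> K" "f z \<le> f x0" and y: "y = subvec f I z"
        by (auto simp: K_zero_def)
      have "z \<in> S" using z by (simp add: S_def less_eq_vec_def)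
      have "g z = l $ j" using fun_cong[OF y, of j] j by (simp add: y_def subvec_def g_def)
      moreover have "(\<lambda>n. g (x (t n))) \<longlonglongrightarrow> Inf (g ` S)"
        using LIMSEQ_subseq_LIMSEQ[OF lim t] by (simp add: o_def)
      ultimately have "g z = Inf (g ` S)"
        using f_lim[OF j] LIMSEQ_unique unfolding g_def by metis
      then show False using unattained[OF \<open>z \<in> S\<close>] Inf_le by fastforce
    qed
    show "(x \<circ> t) k \<in> K \<and> f ((x \<circ> t) k) \<le> f x0" for k using xK xt by simp
    show "filterlim (\<lambda>k. norm ((x \<circ> t) k)) at_top sequentially"
      using filterlim_compose[OF inf filterlim_subseq[OF t]] by simp
    show "(\<lambda>k. subvec f I ((x \<circ> t) k)) \<longlonglongrightarrow> y"
    proof (rule tendsto_fun_componentwise)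
      show "(\<lambda>k. subvec f I ((x \<circ> t) k) i) \<longlonglongrightarrow> y i" for i
        using f_lim[of i] by (cases "i \<in> I") (simp_all add: subvec_def y_def)
    qed
    have tangency: "x n \<in> tangency_variety f K"
        "ereal (norm (x n)) * rabier f K (x n) \<le> ereal (2 * inverse (Suc n))" for n
      using log_penalized_minimizer_tangency[where d = "inverse (Suc n)", OF lip K _ S_def x, of n]
        min[of _ n] unfolding g_def by simp_all
    show "(x \<circ> t) k \<in> tangency_variety f K" for k
      using tangency(1) by simp
    have "(\<lambda>k. 2 * inverse (real (Suc (t k)))) \<longlonglongrightarrow> 2 * 0"
      using LIMSEQ_subseq_LIMSEQ[OF LIMSEQ_inverse_real_of_nat t]
      by (intro tendsto_mult tendsto_const) (simp add: o_def)
    then have "(\<lambda>k. ereal (2 * inverse (real (Suc (t k))))) \<longlonglongrightarrow> 0"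
      by (simp add: zero_ereal_def)
    then show "(\<lambda>k. ereal (norm ((x \<circ> t) k)) * rabier f K ((x \<circ> t) k)) \<longlonglongrightarrow> 0"
      by (rule tendsto_sandwich[OF _ _ tendsto_const, rotated 2])
        (use tangency(2) in \<open>auto intro!: always_eventually ereal_0_le_mult rabier_nonneg\<close>)
  qed
qed


subsection \<open>Weakly efficient points\<close>

text \<open>Take a point below \<open>xs\<close> that shares the fewest objective values with
  \<open>xs\<close>. Moving further down can only lose equalities, so by minimality none is lost and
  these values stay fixed.\<close>

lemma weak_pareto_constant_section:
  fixes f :: "real ^ 'n \<Rightarrow> real ^ 's"
  assumes "weak_pareto_efficient K f xs"
  obtains x0 I where "I \<noteq> {}" "weak_pareto_efficient K f x0"
    "\<And>x i. x \<in> K \<Longrightarrow> f x \<le> f x0 \<Longrightarrow> i \<in> I \<Longrightarrow> f x $ i = f x0 $ i"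
proof -
  define J where "J = (\<lambda>x. {i. f x $ i = f xs $ i})"
  define P where "P = (\<lambda>x. x \<in> K \<and> f x \<le> f xs)"
  have "P xs" using assms by (simp add: P_def weak_pareto_efficient_def)
  then obtain x0 where x0: "P x0" and min: "\<And>x. P x \<Longrightarrow> card (J x0) \<le> card (J x)"
    using ex_has_least_nat[of P xs "\<lambda>x. card (J x)"] by blast
  have "J x0 \<noteq> {}"
  proof
    assume "J x0 = {}"
    then have "\<forall>i. f x0 $ i < f xs $ i"
      using x0 by (auto simp: J_def P_def less_eq_vec_def order_less_le)
    then show False using x0 assms by (auto simp: P_def weak_pareto_efficient_def)
  qed
  moreover have "weak_pareto_efficient K f x0"
    using assms x0 unfolding weak_pareto_efficient_def P_def less_eq_vec_def
    by (meson less_le_trans)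
  moreover have "f x $ i = f x0 $ i" if x: "x \<in> K" "f x \<le> f x0" and i: "i \<in> J x0" for x i
  proof -
    have "P x" using x x0 by (auto simp: P_def)
    moreover have "J x \<subseteq> J x0"
      \<comment> \<open>Where \<open>f x\<close> and \<open>f xs\<close> agree in a component, the
        intermediate \<open>f x0\<close> is squeezed between them.\<close>
      using x x0 unfolding J_def P_def less_eq_vec_def by (metis (mono_tags, lifting) Collect_mono order.antisym)
    ultimately have "J x = J x0" by (intro card_seteq min) auto
    then show ?thesis using i by (auto simp: J_def)
  qed
  ultimately show thesis using that by blast
qed

text \<open>Once the norm is at least 1, multiplying the nonnegative Rabier function by it cannot
  decrease it.\<close>

lemma K_inf_subset_Ktilde_inf: "K_inf f K I y0 \<subseteq> Ktilde_inf f K I y0"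
proof
  fix y assume "y \<in> K_inf f K I y0"
  then obtain x where y: "y \<in> Rvec I" and x: "\<And>k. x k \<in> K \<and> f (x k) \<le> y0"
    and inf: "filterlim (\<lambda>k. norm (x k)) at_top sequentially"
    and lim: "(\<lambda>k. subvec f I (x k)) \<longlonglongrightarrow> y" and nu: "(\<lambda>k. ereal (norm (x k)) * rabier f K (x k)) \<longlonglongrightarrow> 0"
    by (auto simp: K_inf_def)
  have "\<forall>\<^sub>F k in sequentially. 1 \<le> norm (x k)"
    using inf by (simp add: filterlim_at_top)
  then have "\<forall>\<^sub>F k in sequentially. rabier f K (x k) \<le> ereal (norm (x k)) * rabier f K (x k)"
  proof eventually_elim
    fix k assume "1 \<le> norm (x k)"
    then have "1 * rabier f K (x k) \<le> ereal (norm (x k)) * rabier f K (x k)"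
      by (intro ereal_mult_right_mono rabier_nonneg) (simp add: one_ereal_def)
    then show "rabier f K (x k) \<le> ereal (norm (x k)) * rabier f K (x k)" by simp
  qed
  then have "(\<lambda>k. rabier f K (x k)) \<longlonglongrightarrow> 0"
    by (intro tendsto_sandwich[OF _ _ tendsto_const nu]) (auto simp: rabier_nonneg)
  then show "y \<in> Ktilde_inf f K I y0"
    using y x inf lim by (auto simp: Ktilde_inf_def)
qed

section \<open>Equivalence of weak efficiency with the three asymptotic inclusions\<close>

theorem theorem5p1:
  fixes f :: "real ^ 'n \<Rightarrow> real ^ 's" and K :: "(real ^ 'n) set"
  assumes "locally_lipschitz f" and "closed K" and "K \<noteq> {}"
  shows "((\<exists>x. weak_pareto_efficient K f x) \<longleftrightarrow>
            (\<exists>I x0. I \<noteq> {} \<and> x0 \<in> K \<and> weakly_section_bounded_below K f I x0 \<and>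
               Ktilde_inf f K I (f x0) \<subseteq> K_zero f K I (f x0)))
       \<and> ((\<exists>x. weak_pareto_efficient K f x) \<longleftrightarrow>
            (\<exists>I x0. I \<noteq> {} \<and> x0 \<in> K \<and> weakly_section_bounded_below K f I x0 \<and>
               K_inf f K I (f x0) \<subseteq> K_zero f K I (f x0)))
       \<and> ((\<exists>x. weak_pareto_efficient K f x) \<longleftrightarrow>
            (\<exists>I x0. I \<noteq> {} \<and> x0 \<in> K \<and> weakly_section_bounded_below K f I x0 \<and>
               T_inf f K I (f x0) \<subseteq> K_zero f K I (f x0)))"
proof -
  \<comment> \<open>The same \<open>I\<close> and \<open>x0\<close> serve all three
    inclusions.\<close>
  have necessary: "\<exists>I x0. I \<noteq> {} \<and> x0 \<in> K \<and> weakly_section_bounded_below K f I x0 \<and>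
      Ktilde_inf f K I (f x0) \<subseteq> K_zero f K I (f x0) \<and> K_inf f K I (f x0) \<subseteq> K_zero f K I (f x0) \<and>
      T_inf f K I (f x0) \<subseteq> K_zero f K I (f x0)"
    if "\<exists>x. weak_pareto_efficient K f x"
  proof -
    obtain xs where xs: "weak_pareto_efficient K f xs" using \<open>\<exists>x. weak_pareto_efficient K f x\<close> ..
    obtain x0 I where I: "I \<noteq> {}" and x0: "weak_pareto_efficient K f x0"
      and const: "\<And>x i. x \<in> K \<Longrightarrow> f x \<le> f x0 \<Longrightarrow> i \<in> I \<Longrightarrow> f x $ i = f x0 $ i"
      by (rule weak_pareto_constant_section[OF xs]) (rule that; assumption)
    have K: "x0 \<in> K" using x0 by (simp add: weak_pareto_efficient_def)
    have sub: "subvec f I x = subvec f I x0" if "x \<in> K" "f x \<le> f x0" for x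
      using const[OF that] by (auto simp: subvec_def fun_eq_iff)
    have "subvec f I ` section_at K f x0 \<subseteq> {subvec f I x0}"
      by (rule image_subsetI) (simp add: section_at_def sub less_eq_vec_def)
    moreover have "subvec f I x0 \<in> Rvec I" by (simp add: subvec_def Rvec_def)
    ultimately have "weakly_section_bounded_below K f I x0"
      unfolding weakly_section_bounded_below_def by (intro bexI[of _ "subvec f I x0"]) auto
    moreover have "subvec f I x0 \<in> K_zero f K I (f x0)"
      using weak_pareto_efficient_rabier[OF assms(1,2) x0] K by (auto simp: K_zero_def)
    \<comment> \<open>Constancy on the section leaves only one possible asymptotic value.\<close>
    moreover have "y = subvec f I x0"
      if "\<And>k. x k \<in> K \<and> f (x k) \<le> f x0" "(\<lambda>k. subvec f I (x k)) \<longlonglongrightarrow> y" for x :: "nat \<Rightarrow> _" and y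
    proof -
      have "subvec f I (x k) = subvec f I x0" for k using sub that(1) by blast
      then show ?thesis using that(2) by (simp add: LIMSEQ_const_iff)
    qed
    then have "Ktilde_inf f K I (f x0) \<subseteq> {subvec f I x0}" "T_inf f K I (f x0) \<subseteq> {subvec f I x0}"
      by (auto simp: Ktilde_inf_def T_inf_def tangency_variety_def)
    ultimately show ?thesis
      using I K K_inf_subset_Ktilde_inf[of f K I "f x0"] by blast
  qed
  \<comment> \<open>The inclusion for \<open>Ktilde_inf\<close> implies the one for
    \<open>K_inf\<close>, so these two alternatives cover all three assertions.\<close>
  have sufficient: "\<exists>x. weak_pareto_efficient K f x"
    if prems: "x0 \<in> K" "I \<noteq> {}" "weakly_section_bounded_below K f I x0"
      and incl: "K_inf f K I (f x0) \<subseteq> K_zero f K I (f x0) \<or> T_inf f K I (f x0) \<subseteq> K_zero f K I (f x0)"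
    for I x0
  proof (rule ccontr)
    assume no: "\<not> ?thesis"
    obtain y x where "y \<notin> K_zero f K I (f x0)" "y \<in> K_inf f K I (f x0)" "y \<in> T_inf f K I (f x0)"
      by (rule no_weak_pareto_sequence[OF assms(1,2) prems no])
        (auto simp: K_inf_def T_inf_def)
    then show False using incl by blast
  qed
  show ?thesis
  proof (intro conjI iffI)
    assume "\<exists>I x0. I \<noteq> {} \<and> x0 \<in> K \<and> weakly_section_bounded_below K f I x0 \<and>
      Ktilde_inf f K I (f x0) \<subseteq> K_zero f K I (f x0)"
    then obtain I x0 where "I \<noteq> {}" "x0 \<in> K" "weakly_section_bounded_below K f I x0"
      "K_inf f K I (f x0) \<subseteq> K_zero f K I (f x0)"
      using K_inf_subset_Ktilde_inf[of f K] by (elim exE conjE) (rule that; blast)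
    then show "\<exists>x. weak_pareto_efficient K f x" using sufficient by simp
  qed (drule necessary, elim exE conjE, intro exI conjI; assumption | elim exE conjE, rule sufficient, assumption+, simp)+
qed

end
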